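(* Let $G=(V,E)$ be a proper intersection graph of (vertex sets of) paths in some subdivision of a fixed connected graph $H$ with $m$ edges, and let $k$ be the sum of the number of paths in $H$ and the number of cycles in $H$ (i.e., the number of subgraphs of $H$ that are paths plus the number of subgraphs of $H$ that are cycles). Then $G$ is a proper $(m^2k)$-mixed-thin graph.
   Context: Graphs are finite and simple. **Intersection graphs.** The *intersection graph* of a finite collection of sets $\{S_1,\dots,S_n\}$ has a vertex $v_i$ for each $S_i$, and distinct $v_i,v_j$ are adjacent iff $S_i\cap S_j\ne\emptyset$. An intersection graph is *proper* if it is the intersection graph of $\{S_1,\dots,S_n\}$ such that $S_i\not\subseteq S_j$ for all $i\ne j$. So here $G$ is the intersection graph of a collection of vertex sets of paths in a subdivision $H'$ of $H$, none contained in another. Subdividing an edge $uv$ means replacing it with a new vertex $x$ and edges $ux$, $xv$; a subdivision of $H$ is obtained by repeated edge subdivisions. **Proper $k$-mixed-thin.** Let $G=(V,E)$ be a graph, $k>0$ an integer, and $\bar E=\binom{V}{2}\setminus E$. Two linear orders on the same set are *aligned* if they are the same or one is the inverse of the other. $G$ is *proper $k$-mixed-thin* if there exist a partition $(V_1,\ldots,V_k)$ of $V$ and, for each $1\le i\le j\le k$, a linear order $\le_{ij}$ on $V_i\cup V_j$ and a choice of $E_{i,j}\in\{E,\bar E\}$ such that for every $1\le i\le j\le k$ (writing $\lneq_{ij}$ for the strict order): (a) the restriction of $\le_{ij}$ to $V_i$ (resp. to $V_j$) is aligned with $\le_{ii}$ (resp. $\le_{jj}$); (b) for every triple $u,v,w$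 such that ($\{u,v\}\subseteq V_i$ and $w\in V_j$) or ($\{u,v\}\subseteq V_j$ and $w\in V_i$): if $u\lneq_{ij}v\lneq_{ij}w$ and $uw\in E_{i,j}$, then $vw\in E_{i,j}$; (c) for every triple $u,v,w$ such that ($\{v,w\}\subseteq V_i$ and $u\in V_j$) or ($\{v,w\}\subseteq V_j$ and $u\in V_i$): if $u\lneq_{ij}v\lneq_{ij}w$ and $uw\in E_{i,j}$, then $uv\in E_{i,j}$. (Parts of the partition are allowed to be empty.) *)

theory Defs
  imports Main "HOL-Library.Ramsey" "HOL-Library.Disjoint_Sets"
begin

section \<open>Finite simple graphs\<close>

type_synonym 'a sgraph = "'a set \<times> 'a set set"

abbreviation verts :: "'a sgraph \<Rightarrow> 'a set" where "verts G \<equiv> fst G"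
abbreviation edges :: "'a sgraph \<Rightarrow> 'a set set" where "edges G \<equiv> snd G"

definition simple_graph :: "'a sgraph \<Rightarrow> bool" where
  "simple_graph G \<longleftrightarrow> finite (verts G) \<and> edges G \<subseteq> [verts G]\<^bsup>2\<^esup>"

definition connected_graph :: "'a sgraph \<Rightarrow> bool" where
  "connected_graph G \<longleftrightarrow> verts G \<noteq> {} \<and>
     (\<forall>u\<in>verts G. \<forall>v\<in>verts G. (u, v) \<in> {(x, y). {x, y} \<in> edges G}\<^sup>*)"

definition subgraph_of :: "'a sgraph \<Rightarrow> 'a sgraph \<Rightarrow> bool" where
  "subgraph_of F G \<longleftrightarrow> simple_graph F \<and> verts F \<subseteq> verts G \<and> edges F \<subseteq> edges G"

definition consecutive_edges :: "'a list \<Rightarrow> 'a set set" where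
  "consecutive_edges xs = {{xs ! i, xs ! Suc i} | i. Suc i < length xs}"

text \<open>A single vertex is a path (of length 0); the graph without vertices is not.\<close>

definition path_graph :: "'a sgraph \<Rightarrow> bool" where
  "path_graph P \<longleftrightarrow> (\<exists>xs. xs \<noteq> [] \<and> distinct xs \<and> P = (set xs, consecutive_edges xs))"

definition cycle_graph :: "'a sgraph \<Rightarrow> bool" where
  "cycle_graph C \<longleftrightarrow> (\<exists>xs. 3 \<le> length xs \<and> distinct xs \<and>
     C = (set xs, insert {last xs, hd xs} (consecutive_edges xs)))"

text \<open>Paths and cycles are counted as subgraphs: neither a direction of traversal nor a
  starting vertex is recorded.\<close>

definition num_paths :: "'a sgraph \<Rightarrow> nat" where
  "num_paths G = card {P. subgraph_of P G \<and> path_graph P}"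

definition num_cycles :: "'a sgraph \<Rightarrow> nat" where
  "num_cycles G = card {C. subgraph_of C G \<and> cycle_graph C}"


section \<open>Subdivisions and intersection graphs\<close>

inductive subdivision_of :: "'a sgraph \<Rightarrow> 'a sgraph \<Rightarrow> bool" for H :: "'a sgraph" where
  refl: "subdivision_of H H"
| step: "subdivision_of H (V, E) \<Longrightarrow> {u, v} \<in> E \<Longrightarrow> x \<notin> V \<Longrightarrow>
    subdivision_of H (insert x V, (E - {{u, v}}) \<union> {{u, x}, {x, v}})"

definition path_vertex_sets :: "'a sgraph \<Rightarrow> 'a set set" where
  "path_vertex_sets G = {verts P | P. subgraph_of P G \<and> path_graph P}"

text \<open>The vertices of \<open>G\<close> serve as the index set of the collection \<open>S\<close>.\<close>

definition intersection_graph_of :: "'v sgraph \<Rightarrow> ('v \<Rightarrow> 'a set) \<Rightarrow> bool" where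
  "intersection_graph_of G S \<longleftrightarrow> finite (verts G) \<and>
     edges G = {{u, v} | u v. u \<in> verts G \<and> v \<in> verts G \<and> u \<noteq> v \<and> S u \<inter> S v \<noteq> {}}"

definition proper_intersection_graph :: "'v sgraph \<Rightarrow> 'a set set \<Rightarrow> bool" where
  "proper_intersection_graph G \<F> \<longleftrightarrow>
     (\<exists>S. (\<forall>v\<in>verts G. S v \<in> \<F>) \<and> intersection_graph_of G S \<and>
          (\<forall>u\<in>verts G. \<forall>v\<in>verts G. u \<noteq> v \<longrightarrow> \<not> S u \<subseteq> S v))"


section \<open>Proper mixed-thin graphs\<close>

definition restrict_rel :: "'a rel \<Rightarrow> 'a set \<Rightarrow> 'a rel" where
  "restrict_rel r A = r \<inter> A \<times> A"

definition aligned :: "'a rel \<Rightarrow> 'a rel \<Rightarrow> bool" where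
  "aligned r s \<longleftrightarrow> r = s \<or> r = s\<inverse>"

definition strictly :: "'a rel \<Rightarrow> 'a \<Rightarrow> 'a \<Rightarrow> bool" where
  "strictly r x y \<longleftrightarrow> (x, y) \<in> r \<and> x \<noteq> y"

text \<open>\<open>Vp i\<close> is the \<open>i\<close>-th part (possibly empty), \<open>le i j\<close> the order on
  \<open>Vp i \<union> Vp j\<close> as a reflexive relation, and \<open>EE i j\<close> is \<open>E\<close> or its complement
  within the two-element subsets of the vertex set.\<close>

definition proper_mixed_thin :: "nat \<Rightarrow> 'a sgraph \<Rightarrow> bool" where
  "proper_mixed_thin k G \<longleftrightarrow> k > 0 \<and>
    (\<exists>(Vp :: nat \<Rightarrow> 'a set) (le :: nat \<Rightarrow> nat \<Rightarrow> 'a rel) (EE :: nat \<Rightarrow> nat \<Rightarrow> 'a set set).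
       (\<Union>i\<in>{1..k}. Vp i) = verts G \<and> disjoint_family_on Vp {1..k} \<and>
       (\<forall>i j. 1 \<le> i \<and> i \<le> j \<and> j \<le> k \<longrightarrow>
          linear_order_on (Vp i \<union> Vp j) (le i j) \<and>
          EE i j \<in> {edges G, [verts G]\<^bsup>2\<^esup> - edges G} \<and>
          aligned (restrict_rel (le i j) (Vp i)) (le i i) \<and>
          aligned (restrict_rel (le i j) (Vp j)) (le j j) \<and>
          (\<forall>u v w. ({u, v} \<subseteq> Vp i \<and> w \<in> Vp j \<or> {u, v} \<subseteq> Vp j \<and> w \<in> Vp i) \<longrightarrow>
             strictly (le i j) u v \<and> strictly (le i j) v w \<and> {u, w} \<in> EE i j \<longrightarrow>
             {v, w} \<in> EE i j) \<and>
          (\<forall>u v w. ({v, w} \<subseteq> Vp i \<and> u \<in> Vp j \<or> {v, w} \<subseteq> Vp j \<and> u \<in> Vp i) \<longrightarrow>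
             strictly (le i j) u v \<and> strictly (le i j) v w \<and> {u, w} \<in> EE i j \<longrightarrow>
             {u, v} \<in> EE i j)))"

end

(* Cut every path representing a vertex of G at the vertices of H: it is either contained in
   one subdivided edge, or it consists of a fully covered path of H and of two tails that end
   inside subdivided edges. In the first case it is an interval of that edge, in the second it
   is determined, within the class given by the path of H and the edges of the two tails, by
   the lengths of the tails. As no path contains another, within a class one coordinate is
   monotone in the other. For two classes, either all pairs meet, or the pairs that are disjoint
   (for two distinct edges, those that meet) are described by two inequalities, one for each
   coordinate; sorting both classes by one of them gives the required order. *)

theory Submission
  imports Defs "HOL-Library.Product_Lexorder"
begin

section \<open>Merging two ranked classes\<close>

text \<open>Sorting settles only the inequality that is sorted by; the second one survives only if
  it runs the opposite way along each class, which is what the antichain provides. The obstacle is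
  therefore to get by with one inequality per coordinate, although two tailed paths offer four pairs
  of tails. For this the class records the starting vertex and the edge of each tail. The two tails
  of a path never leave the same vertex along the same edge (such a path is an interval of that
  edge), so each tail can collide with at most one tail of the other class. Alignment comes from
  ranking all classes by their first coordinate: every merged order restricts to this rank or to its
  reverse. The factor \<open>m ^ 2\<close> counts the edges of the two tails. Paths of
  \<open>H\<close> are counted without direction, so one traversal of each is fixed, which also
  tells the two tails apart.\<close>

definition rank_order :: "('v \<Rightarrow> 'b::linorder) \<Rightarrow> 'v set \<Rightarrow> 'v rel" where
  "rank_order \<rho> A = {(u, v). u \<in> A \<and> v \<in> A \<and> \<rho> u \<le> \<rho> v}"

lemma linear_order_rank_order:
  assumes "inj_on \<rho> A"
  shows "linear_order_on A (rank_order \<rho> A)"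
  using assms
  by (auto simp: linear_order_on_def partial_order_on_def preorder_on_def refl_on_def trans_def
      antisym_def total_on_def rank_order_def inj_on_def)

lemma aligned_sym: "aligned r s \<Longrightarrow> aligned s r"
  by (auto simp: aligned_def)

lemma aligned_trans: "aligned r s \<Longrightarrow> aligned s t \<Longrightarrow> aligned r t"
  by (auto simp: aligned_def)

definition compatible_order :: "'v set set \<Rightarrow> 'v set \<Rightarrow> 'v set \<Rightarrow> 'v rel \<Rightarrow> bool" where
  "compatible_order F A B le \<longleftrightarrow>
     (\<forall>u v w. ({u, v} \<subseteq> A \<and> w \<in> B \<or> {u, v} \<subseteq> B \<and> w \<in> A) \<longrightarrow>
        strictly le u v \<and> strictly le v w \<and> {u, w} \<in> F \<longrightarrow> {v, w} \<in> F) \<and>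
     (\<forall>u v w. ({v, w} \<subseteq> A \<and> u \<in> B \<or> {v, w} \<subseteq> B \<and> u \<in> A) \<longrightarrow>
        strictly le u v \<and> strictly le v w \<and> {u, w} \<in> F \<longrightarrow> {u, v} \<in> F)"

definition compatible :: "'v sgraph \<Rightarrow> ('v \<Rightarrow> int) \<Rightarrow> 'v set \<Rightarrow> 'v set \<Rightarrow> bool" where
  "compatible G \<rho> A B \<longleftrightarrow> (\<exists>le F. linear_order_on (A \<union> B) le \<and>
     F \<in> {edges G, [verts G]\<^bsup>2\<^esup> - edges G} \<and>
     aligned (restrict_rel le A) (rank_order \<rho> A) \<and>
     aligned (restrict_rel le B) (rank_order \<rho> B) \<and> compatible_order F A B le)"

lemma compatible_order_sym: "compatible_order F A B le \<Longrightarrow> compatible_order F B A le"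
  unfolding compatible_order_def by meson

lemma compatible_sym: "compatible G \<rho> A B \<Longrightarrow> compatible G \<rho> B A"
  unfolding compatible_def by (metis compatible_order_sym sup_commute)

text \<open>The orders are found for each pair of classes on its own. They fit together because
  every restriction, and also the diagonal order \<open>le i i\<close>, is aligned with the order of
  the same \<open>\<rho>\<close>, and alignment is symmetric and transitive.\<close>

lemma proper_mixed_thin_if_compatible:
  assumes n: "n > 0" and \<kappa>: "\<kappa> ` verts G \<subseteq> {1..n}"
    and comp: "\<And>i j. i \<le> j \<Longrightarrow>
      compatible G \<rho> {v \<in> verts G. \<kappa> v = i} {v \<in> verts G. \<kappa> v = j}"
  shows "proper_mixed_thin n G"
proof -
  define Vp where "Vp i = {v \<in> verts G. \<kappa> v = i}" for i
  have "\<forall>i j. \<exists>le F. i \<le> j \<longrightarrow> linear_order_on (Vp i \<union> Vp j) le \<and>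
     F \<in> {edges G, [verts G]\<^bsup>2\<^esup> - edges G} \<and>
     aligned (restrict_rel le (Vp i)) (rank_order \<rho> (Vp i)) \<and>
     aligned (restrict_rel le (Vp j)) (rank_order \<rho> (Vp j)) \<and> compatible_order F (Vp i) (Vp j) le"
    using comp unfolding compatible_def Vp_def by meson
  then obtain le F where leF: "\<And>i j. i \<le> j \<Longrightarrow> linear_order_on (Vp i \<union> Vp j) (le i j) \<and>
     F i j \<in> {edges G, [verts G]\<^bsup>2\<^esup> - edges G} \<and>
     aligned (restrict_rel (le i j) (Vp i)) (rank_order \<rho> (Vp i)) \<and>
     aligned (restrict_rel (le i j) (Vp j)) (rank_order \<rho> (Vp j)) \<and>
     compatible_order (F i j) (Vp i) (Vp j) (le i j)"
    by metis
  have "restrict_rel (le i i) (Vp i) = le i i" for i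
    using leF[of i i]
    by (auto simp: restrict_rel_def linear_order_on_def partial_order_on_def preorder_on_def
        refl_on_def)
  then have le_diag: "aligned (rank_order \<rho> (Vp i)) (le i i)" for i
    using leF[of i i] aligned_sym by force
  have al: "aligned (restrict_rel (le i j) (Vp i)) (le i i)"
    "aligned (restrict_rel (le i j) (Vp j)) (le j j)" if "i \<le> j" for i j
    using leF[OF that] le_diag aligned_trans by blast+
  have "(\<Union>i\<in>{1..n}. Vp i) = verts G" "disjoint_family_on Vp {1..n}"
    using \<kappa> by (auto simp: Vp_def disjoint_family_on_def)
  moreover have "linear_order_on (Vp i \<union> Vp j) (le i j) \<and>
      F i j \<in> {edges G, [verts G]\<^bsup>2\<^esup> - edges G} \<and>
      aligned (restrict_rel (le i j) (Vp i)) (le i i) \<and>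
      aligned (restrict_rel (le i j) (Vp j)) (le j j) \<and>
      compatible_order (F i j) (Vp i) (Vp j) (le i j)" if "i \<le> j" for i j
    using leF[OF that] al[OF that] by (intro conjI) (elim conjE, assumption)+
  ultimately show ?thesis
    unfolding proper_mixed_thin_def compatible_order_def[symmetric] using n by blast
qed

text \<open>Both monotonicities are weak, so a constant function can stand for an absent
  inequality.\<close>

definition opposed :: "('v \<Rightarrow> int) \<Rightarrow> 'v set \<Rightarrow> ('v \<Rightarrow> int) \<Rightarrow> ('v \<Rightarrow> int) \<Rightarrow> bool" where
  "opposed \<rho> A x y \<longleftrightarrow> (\<forall>u\<in>A. \<forall>v\<in>A. \<rho> u \<le> \<rho> v \<longrightarrow> x u \<le> x v \<and> y v \<le> y u)"

text \<open>Sorting both classes by the coordinates \<open>x\<close> and \<open>X\<close>, with ties broken in favour of \<open>A\<close>,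
  a pair \<open>u \<in> A\<close>, \<open>w \<in> B\<close> of \<open>F\<close> always has \<open>u\<close> before \<open>w\<close>. Moving \<open>u\<close> and \<open>w\<close>
  towards each other then preserves the inequality of the first coordinates by the choice
  of the order, and that of the second ones by antitonicity.\<close>

lemma compatible_if_opposed_aux:
  assumes disj: "A \<inter> B = {}" and inj: "inj_on \<rho> A" "inj_on \<rho> B"
    and A: "opposed \<rho> A x y" and B: "opposed \<rho> B X Y \<or> opposed \<rho> B Y X"
    and F: "F \<in> {edges G, [verts G]\<^bsup>2\<^esup> - edges G}"
    and iff: "\<And>u w. u \<in> A \<Longrightarrow> w \<in> B \<Longrightarrow> {u, w} \<in> F \<longleftrightarrow> x u \<le> X w \<and> y u \<le> Y w"
  shows "compatible G \<rho> A B"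
proof -
  \<comment> \<open>If \<open>\<rho>\<close> runs against \<open>X\<close> on \<open>B\<close>, the
    reversed rank is used there; alignment permits this for each class separately.\<close>
  obtain s :: int where s: "s = 1 \<or> s = -1" and Bs: "opposed (\<lambda>w. s * \<rho> w) B X Y"
    using B
  proof
    assume "opposed \<rho> B X Y" then show ?thesis using that[of 1] by simp
  next
    assume "opposed \<rho> B Y X" then show ?thesis
      using that[of "-1"] by (simp add: opposed_def)
  qed
  \<comment> \<open>The third component separates elements of one class with equal first coordinate.
    As that coordinate is monotone in the rank, the lexicographic order within a class is just the
    order of the (signed) rank.\<close>
  define pos :: "'a \<Rightarrow> int \<times> nat \<times> int" where
    "pos v = (if v \<in> A then (x v, 0, \<rho> v) else (X v, 1, s * \<rho> v))" for v
  define le where "le = rank_order pos (A \<union> B)"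
  have posA: "pos u \<le> pos v \<longleftrightarrow> \<rho> u \<le> \<rho> v" if "u \<in> A" "v \<in> A" for u v
    using that A unfolding opposed_def pos_def by (auto simp: less_eq_prod_def) (smt (verit))+
  have posB: "pos u \<le> pos v \<longleftrightarrow> s * \<rho> u \<le> s * \<rho> v" if "u \<in> B" "v \<in> B" for u v
  proof -
    have "u \<notin> A" "v \<notin> A" using that disj by auto
    then show ?thesis
      using that Bs unfolding opposed_def pos_def by (auto simp: less_eq_prod_def) (smt (verit))+
  qed
  have posAB: "pos u \<le> pos w \<longleftrightarrow> x u \<le> X w" "pos w \<le> pos u \<longleftrightarrow> X w < x u"
    if "u \<in> A" "w \<in> B" for u w
  proof -
    have "w \<notin> A" using that disj by auto
    then show "pos u \<le> pos w \<longleftrightarrow> x u \<le> X w" "pos w \<le> pos u \<longleftrightarrow> X w < x u"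
      using that unfolding pos_def by (auto simp: less_eq_prod_def)
  qed
  have "inj_on pos (A \<union> B)"
    using inj s disj by (auto simp: inj_on_def pos_def split: if_splits)
  then have lin: "linear_order_on (A \<union> B) le"
    unfolding le_def by (rule linear_order_rank_order)
  have "restrict_rel le A = rank_order \<rho> A"
    using posA by (auto simp: restrict_rel_def le_def rank_order_def)
  then have alA: "aligned (restrict_rel le A) (rank_order \<rho> A)" by (simp add: aligned_def)
  have "restrict_rel le B = rank_order (\<lambda>w. s * \<rho> w) B"
    using posB by (auto simp: restrict_rel_def le_def rank_order_def)
  then have alB: "aligned (restrict_rel le B) (rank_order \<rho> B)"
    using s by (auto simp: aligned_def rank_order_def)
  have st: "pos u \<le> pos v" if "strictly le u v" for u v
    using that by (auto simp: strictly_def le_def rank_order_def)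
  have iff': "{w, u} \<in> F \<longleftrightarrow> x u \<le> X w \<and> y u \<le> Y w" if "u \<in> A" "w \<in> B" for u w
    using iff[OF that] by (simp add: insert_commute)
  have 1: "{v, w} \<in> F" if "{u, v} \<subseteq> A \<and> w \<in> B \<or> {u, v} \<subseteq> B \<and> w \<in> A"
    "pos u \<le> pos v" "pos v \<le> pos w" "{u, w} \<in> F" for u v w
  proof (cases "{u, v} \<subseteq> A \<and> w \<in> B")
    case True
    then have "x u \<le> X w" "y u \<le> Y w" "x v \<le> X w" "\<rho> u \<le> \<rho> v"
      using that iff posAB posA by auto
    with True A show ?thesis by (auto simp: iff opposed_def) (smt (verit))
  next
    case False
    then have "x w \<le> X u" "\<not> x w \<le> X u"
      using that iff' posAB(2)[of w u] by (auto intro: order_trans)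
    then show ?thesis by simp
  qed
  have 2: "{u, v} \<in> F" if "{v, w} \<subseteq> A \<and> u \<in> B \<or> {v, w} \<subseteq> B \<and> u \<in> A"
    "pos u \<le> pos v" "pos v \<le> pos w" "{u, w} \<in> F" for u v w
  proof (cases "{v, w} \<subseteq> B \<and> u \<in> A")
    case True
    then have "x u \<le> X w" "y u \<le> Y w" "x u \<le> X v" "s * \<rho> v \<le> s * \<rho> w"
      using that iff posAB posB by auto
    with True Bs show ?thesis by (auto simp: iff opposed_def) (smt (verit))
  next
    case False
    then have "x w \<le> X u" "\<not> x w \<le> X u"
      using that iff' posAB(2)[of w u] by (auto intro: order_trans)
    then show ?thesis by simp
  qed
  have "compatible_order F A B le"
    unfolding compatible_order_def
    by (intro conjI allI impI; elim conjE) (erule 1 2; auto intro: st)+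
  with lin F alA alB show ?thesis unfolding compatible_def by blast
qed

text \<open>The two inequalities play symmetric roles: if \<open>x\<close> decreases along
  \<open>A\<close>, exchange the coordinates in both classes.\<close>

lemma compatible_if_opposed:
  assumes "A \<inter> B = {}" "inj_on \<rho> A" "inj_on \<rho> B"
    and A: "opposed \<rho> A x y \<or> opposed \<rho> A y x" and B: "opposed \<rho> B X Y \<or> opposed \<rho> B Y X"
    and "F \<in> {edges G, [verts G]\<^bsup>2\<^esup> - edges G}"
    and "\<And>u w. u \<in> A \<Longrightarrow> w \<in> B \<Longrightarrow> {u, w} \<in> F \<longleftrightarrow> x u \<le> X w \<and> y u \<le> Y w"
  shows "compatible G \<rho> A B"
  using A
proof
  assume "opposed \<rho> A x y"
  then show ?thesis using assms compatible_if_opposed_aux by metis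
next
  assume "opposed \<rho> A y x"
  then show ?thesis
    using assms compatible_if_opposed_aux[of A B \<rho> y x Y X F G] by blast
qed

lemma compatible_empty:
  assumes "inj_on \<rho> B"
  shows "compatible G \<rho> {} B"
  using assms
  by (intro compatible_if_opposed[where x = "\<lambda>_. 0" and y = "\<lambda>_. 0" and X = "\<lambda>_. 0" and Y = "\<lambda>_. 0"
        and F = "edges G"]) (auto simp: opposed_def)

lemma compatible_diagonal:
  assumes "inj_on \<rho> A" and F: "F \<in> {edges G, [verts G]\<^bsup>2\<^esup> - edges G}"
    and "\<And>u v w. \<lbrakk>{u, v, w} \<subseteq> A; \<rho> u < \<rho> v; \<rho> v < \<rho> w; {u, w} \<in> F\<rbrakk> \<Longrightarrow> {u, v} \<in> F \<and> {v, w} \<in> F"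
  shows "compatible G \<rho> A A"
proof -
  have "restrict_rel (rank_order \<rho> A) A = rank_order \<rho> A"
    by (auto simp: restrict_rel_def rank_order_def)
  moreover have "strictly (rank_order \<rho> A) u v \<longleftrightarrow> u \<in> A \<and> v \<in> A \<and> \<rho> u < \<rho> v" for u v
    using assms(1) by (auto simp: strictly_def rank_order_def inj_on_def less_le)
  then have "compatible_order F A A (rank_order \<rho> A)"
    unfolding compatible_order_def using assms(3) by auto
  ultimately show ?thesis
    unfolding compatible_def using linear_order_rank_order[OF assms(1)] F
    by (intro exI[of _ "rank_order \<rho> A"] exI[of _ F]) (simp add: aligned_def)
qed

section \<open>Consecutive edges of a list\<close>

lemma consecutive_edges_simps [simp]:
  "consecutive_edges [] = {}"
  "consecutive_edges [a] = {}"
  "consecutive_edges (a # b # xs) = insert {a, b} (consecutive_edges (b # xs))"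
proof -
  show "consecutive_edges [] = {}" "consecutive_edges [a] = {}"
    by (simp_all add: consecutive_edges_def)
  have "consecutive_edges (a # b # xs) =
      (\<lambda>i. {(a # b # xs) ! i, (b # xs) ! i}) ` {i. i < Suc (length xs)}"
    by (auto simp: consecutive_edges_def)
  also have "{i. i < Suc (length xs)} = insert 0 (Suc ` {i. i < length xs})"
    by (auto simp: image_iff less_Suc_eq_0_disj)
  also have "(\<lambda>i. {(a # b # xs) ! i, (b # xs) ! i}) ` \<dots> =
      insert {a, b} (consecutive_edges (b # xs))"
    by (auto simp: consecutive_edges_def image_image)
  finally show "consecutive_edges (a # b # xs) = insert {a, b} (consecutive_edges (b # xs))" .
qed

lemma consecutive_edges_Cons:
  "xs \<noteq> [] \<Longrightarrow> consecutive_edges (a # xs) = insert {a, hd xs} (consecutive_edges xs)"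
  by (cases xs) auto

lemma consecutive_edges_append_Cons:
  "consecutive_edges (xs @ p # ys) = consecutive_edges (xs @ [p]) \<union> consecutive_edges (p # ys)"
proof (induction xs)
  case (Cons a xs)
  then show ?case by (cases xs) auto
qed simp

lemma consecutive_edges_rev [simp]: "consecutive_edges (rev xs) = consecutive_edges xs"
proof (induction xs)
  case (Cons a xs)
  show ?case
  proof (cases xs)
    case xs: (Cons b ys)
    have "consecutive_edges (rev (a # xs)) = consecutive_edges (rev ys @ b # [a])"
      by (simp add: xs)
    also have "\<dots> = consecutive_edges (rev xs) \<union> {{b, a}}"
      by (subst consecutive_edges_append_Cons) (simp add: xs)
    finally show ?thesis using Cons xs by auto
  qed simp
qed simp

lemma consecutive_edges_subset: "e \<in> consecutive_edges xs \<Longrightarrow> e \<subseteq> set xs"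
  by (auto simp: consecutive_edges_def)

lemma consecutive_edges_in_nsets:
  assumes "distinct xs"
  shows "consecutive_edges xs \<subseteq> [set xs]\<^bsup>2\<^esup>"
proof
  fix e assume "e \<in> consecutive_edges xs"
  then obtain i where "e = {xs ! i, xs ! Suc i}" "Suc i < length xs"
    by (auto simp: consecutive_edges_def)
  moreover from this have "xs ! i \<noteq> xs ! Suc i"
    using assms by (simp add: nth_eq_iff_index_eq)
  ultimately show "e \<in> [set xs]\<^bsup>2\<^esup>" by (simp add: nsets_def)
qed

text \<open>The only edge at the common head yields the second vertex; remove the head and
  repeat.\<close>

lemma path_list_unique_if_hd_eq:
  assumes "distinct xs" "distinct ys" "xs \<noteq> []" "ys \<noteq> []" "hd xs = hd ys"
    and "set xs = set ys" "consecutive_edges xs = consecutive_edges ys"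
  shows "xs = ys"
  using assms
proof (induction xs arbitrary: ys)
  case (Cons a xs)
  then obtain ys' where ys: "ys = a # ys'" by (cases ys) auto
  have eq: "set xs = set ys'" using Cons.prems ys by auto
  show ?case
  proof (cases "xs = []")
    case True
    then show ?thesis using eq ys by auto
  next
    case False
    then have ne: "ys' \<noteq> []" using eq by auto
    have notin: "a \<notin> set xs" "a \<notin> set ys'" using Cons.prems ys by auto
    have no: "{a, b} \<notin> consecutive_edges xs" "{a, b} \<notin> consecutive_edges ys'" for b
      using consecutive_edges_subset[of "{a, b}"] notin by auto
    have eqs: "insert {a, hd xs} (consecutive_edges xs) = insert {a, hd ys'} (consecutive_edges ys')"
      using Cons.prems ys False ne by (simp add: consecutive_edges_Cons)
    then have "{a, hd xs} = {a, hd ys'}" using no by blast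
    then have hd: "hd xs = hd ys'" by (auto simp: doubleton_eq_iff)
    then have "consecutive_edges xs = consecutive_edges ys'"
      using eqs no[of "hd xs"] no[of "hd ys'"] by (simp add: insert_ident)
    then have "xs = ys'" using Cons.IH[of ys'] Cons.prems ys eq hd False ne by simp
    then show ?thesis using ys by simp
  qed
qed simp

lemma path_list_end_unique:
  assumes "distinct xs" "xs \<noteq> []" "{hd xs, b} \<in> consecutive_edges xs"
    "{hd xs, c} \<in> consecutive_edges xs"
  shows "b = c"
proof -
  obtain a ys where xs: "xs = a # ys" using assms by (cases xs) auto
  then have ne: "ys \<noteq> []" using assms by auto
  have "{a, z} \<notin> consecutive_edges ys" for z
    using consecutive_edges_subset[of "{a, z}"] assms(1) xs by auto
  then show ?thesis using assms ne xs by (auto simp: consecutive_edges_Cons doubleton_eq_iff)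
qed

text \<open>An inner entry of \<open>xs\<close> has two neighbours, but the head of
  \<open>ys\<close> has at most one. So it is an end of \<open>xs\<close>, and reversal reduces to
  equal heads.\<close>

lemma path_list_unique:
  assumes "distinct xs" "distinct ys" "xs \<noteq> []" "ys \<noteq> []"
    and "set xs = set ys" "consecutive_edges xs = consecutive_edges ys"
  shows "ys = xs \<or> ys = rev xs"
proof -
  have "hd ys \<in> set xs" using assms by simp
  then obtain as bs where xs: "xs = as @ hd ys # bs" by (meson split_list)
  have "as = [] \<or> bs = []"
  proof (rule ccontr)
    assume "\<not> (as = [] \<or> bs = [])"
    then obtain as' b c bs' where *: "as = as' @ [b]" "bs = c # bs'"
      by (metis list.exhaust rev_exhaust)
    have "consecutive_edges xs = consecutive_edges (as' @ [b]) \<union>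
        insert {b, hd ys} (insert {hd ys, c} (consecutive_edges (c # bs')))"
      unfolding xs * using consecutive_edges_append_Cons[of as' b "hd ys # c # bs'"] by simp
    then have "{hd ys, b} \<in> consecutive_edges ys" "{hd ys, c} \<in> consecutive_edges ys"
      using assms(6) by (auto simp: insert_commute)
    then have "b = c" using path_list_end_unique assms by metis
    then show False using assms(1) xs * by auto
  qed
  then show ?thesis
  proof
    assume "as = []"
    then have "hd xs = hd ys" using xs by (metis append_Nil list.sel(1))
    then show ?thesis using path_list_unique_if_hd_eq assms by metis
  next
    assume "bs = []"
    then have "hd (rev xs) = hd ys" using xs by (metis hd_rev last_snoc)
    then have "rev xs = ys" using assms by (intro path_list_unique_if_hd_eq) auto
    then show ?thesis by blast
  qed
qed

section \<open>Subdivisions\<close>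

text \<open>\<open>I u v\<close> lists the vertices subdividing the edge \<open>uv\<close>, from \<open>u\<close> to \<open>v\<close>.\<close>

locale segments =
  fixes H :: "'a sgraph" and I :: "'a \<Rightarrow> 'a \<Rightarrow> 'a list"
  assumes simple: "simple_graph H"
    and I_rev: "{u, v} \<in> edges H \<Longrightarrow> I v u = rev (I u v)"
    and I_distinct: "{u, v} \<in> edges H \<Longrightarrow> distinct (I u v)"
    and I_verts: "{u, v} \<in> edges H \<Longrightarrow> set (I u v) \<inter> verts H = {}"
    and I_disjoint: "\<lbrakk>{u, v} \<in> edges H; {u', v'} \<in> edges H; z \<in> set (I u v); z \<in> set (I u' v')\<rbrakk>
      \<Longrightarrow> {u, v} = {u', v'}"
begin

definition chain :: "'a \<Rightarrow> 'a \<Rightarrow> 'a list" where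
  "chain u v = u # I u v @ [v]"

definition inner :: "'a set set \<Rightarrow> 'a set" where
  "inner F = {z. \<exists>u v. {u, v} \<in> F \<and> z \<in> set (I u v)}"

definition chain_edges :: "'a set set" where
  "chain_edges = {e. \<exists>u v. {u, v} \<in> edges H \<and> e \<in> consecutive_edges (chain u v)}"

lemma edge_neq: "{u, v} \<in> edges H \<Longrightarrow> u \<noteq> v"
  using simple by (auto simp: simple_graph_def nsets_def)

lemma edge_verts: "{u, v} \<in> edges H \<Longrightarrow> u \<in> verts H \<and> v \<in> verts H"
  using simple by (auto simp: simple_graph_def nsets_def)

lemma edge_cases:
  assumes "e \<in> edges H"
  obtains u v where "e = {u, v}"
  using simple assms by (auto simp: simple_graph_def nsets_def card_2_iff)

end

section \<open>Every subdivision is described by lists of subdividing vertices\<close>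

lemma consecutive_edges_insert:
  assumes "Suc i < length xs"
  shows "consecutive_edges xs - {{xs ! i, xs ! Suc i}} \<union> {{xs ! i, x}, {x, xs ! Suc i}}
    \<subseteq> consecutive_edges (take (Suc i) xs @ x # drop (Suc i) xs)"
proof -
  define p q as bs where "p = xs ! i" "q = xs ! Suc i" "as = take i xs" "bs = drop (Suc (Suc i)) xs"
  have 1: "take (Suc i) xs = as @ [p]" "drop (Suc i) xs = q # bs"
    using assms by (simp_all add: p_q_as_bs_def take_Suc_conv_app_nth Cons_nth_drop_Suc)
  then have "xs = as @ p # q # bs" by (metis append.assoc append_Cons append_Nil append_take_drop_id)
  then have "consecutive_edges xs = consecutive_edges (as @ [p]) \<union> {{p, q}} \<union> consecutive_edges (q # bs)"
    using consecutive_edges_append_Cons[of as p "q # bs"] by simp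
  moreover have "consecutive_edges (take (Suc i) xs @ x # drop (Suc i) xs) =
      consecutive_edges (as @ [p]) \<union> {{p, x}, {x, q}} \<union> consecutive_edges (q # bs)"
    using consecutive_edges_append_Cons[of as p "x # q # bs"] 1 by simp
  ultimately show ?thesis using p_q_as_bs_def by auto
qed

text \<open>The edge to be subdivided lies on the chain of some edge \<open>{a, b}\<close> of
  \<open>H\<close>, so the step only inserts \<open>x\<close> into \<open>I a b\<close>.
  Disjointness of the lists persists because \<open>x\<close> is new.\<close>

lemma segments_step:
  assumes seg: "segments H I"
    and V: "V = verts H \<union> segments.inner I (edges H)"
    and E: "E \<subseteq> segments.chain_edges H I"
    and uv: "{u, v} \<in> E" and x: "x \<notin> V"
  obtains I' where "segments H I'" "insert x V = verts H \<union> segments.inner I' (edges H)"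
    "(E - {{u, v}}) \<union> {{u, x}, {x, v}} \<subseteq> segments.chain_edges H I'"
proof -
  interpret segments H I by fact
  obtain a b where ab: "{a, b} \<in> edges H" and "{u, v} \<in> consecutive_edges (chain a b)"
    using E uv by (auto simp: chain_edges_def)
  then obtain i where i: "Suc i < length (chain a b)"
    "{u, v} = {chain a b ! i, chain a b ! Suc i}"
    by (auto simp: consecutive_edges_def)
  have neq: "a \<noteq> b" using ab edge_neq by auto
  have ba: "{b, a} \<in> edges H" using ab by (simp add: insert_commute)
  \<comment> \<open>Since \<open>a\<close> has position 0 in \<open>chain a b\<close>, a vertex
    placed after position \<open>i\<close> of the chain follows the first \<open>i\<close> entries
    of \<open>I a b\<close>.\<close>
  define J where "J = take i (I a b) @ x # drop i (I a b)"
  \<comment> \<open>The first two cases exclude each other as \<open>a\<close> and \<open>b\<close>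
    differ; \<open>rev J\<close> keeps \<open>I_rev\<close> valid.\<close>
  define I' where "I' c d = (if (c, d) = (a, b) then J else if (c, d) = (b, a) then rev J
    else I c d)" for c d
  have setJ: "set J = insert x (set (I a b))"
    unfolding J_def by (metis Un_insert_right append_take_drop_id list.simps(15) set_append)
  have fresh: "x \<notin> set (I c d)" if "{c, d} \<in> edges H" for c d
    using x V that by (auto simp: inner_def)
  have distJ: "distinct J"
    using I_distinct[OF ab] fresh[OF ab] unfolding J_def
    by (auto dest: in_set_takeD in_set_dropD simp: set_take_disj_set_drop_if_distinct)
  have same: "I' c d = I c d" if "{c, d} \<noteq> {a, b}" for c d :: 'a
  proof -
    have "\<not> (c = a \<and> d = b)" "\<not> (c = b \<and> d = a)" using that by (simp_all add: doubleton_eq_iff)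
    then show ?thesis unfolding I'_def prod.inject by (simp only: if_False)
  qed
  have new: "set (I' c d) = insert x (set (I a b))" "distinct (I' c d)" "set (I c d) = set (I a b)"
    if "{c, d} = {a, b}" for c d
    using that setJ distJ I_rev[OF ab] by (auto simp: I'_def doubleton_eq_iff)
  have seg': "segments H I'"
  proof
    show "simple_graph H" by (rule simple)
    fix c d assume cd: "{c, d} \<in> edges H"
    show "I' d c = rev (I' c d)"
      using I_rev[OF cd] neq by (auto simp: I'_def)
    show "distinct (I' c d)"
      using I_distinct[OF cd] same new by metis
    show "set (I' c d) \<inter> verts H = {}"
      using I_verts[OF cd] I_verts[OF ab] x V same[of c d] new(1)[of c d]
      by (cases "{c, d} = {a, b}") auto
    fix c' d' z assume cd': "{c', d'} \<in> edges H" and z: "z \<in> set (I' c d)" "z \<in> set (I' c' d')"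
    show "{c, d} = {c', d'}"
    proof (cases "{c, d} = {a, b}"; cases "{c', d'} = {a, b}")
      assume "{c, d} = {a, b}" "{c', d'} \<noteq> {a, b}"
      then show ?thesis using z new(1)[of c d] same[of c' d'] I_disjoint[OF ab cd', of z] fresh[OF cd']
        by auto
    next
      assume "{c, d} \<noteq> {a, b}" "{c', d'} = {a, b}"
      then show ?thesis using z new(1)[of c' d'] same[of c d] I_disjoint[OF cd ab, of z] fresh[OF cd]
        by auto
    next
      assume "{c, d} \<noteq> {a, b}" "{c', d'} \<noteq> {a, b}"
      then show ?thesis using z same[of c d] same[of c' d'] I_disjoint[OF cd cd', of z] by simp
    qed simp
  qed
  interpret S': segments H I' by (rule seg')
  have "set (I' c d) \<subseteq> insert x (set (I c d))" "set (I c d) \<subseteq> set (I' c d)" for c d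
    using same[of c d] new[of c d] by (cases "{c, d} = {a, b}"; auto)+
  moreover have "x \<in> set (I' a b)" using new(1)[of a b] by simp
  ultimately have "S'.inner (edges H) = insert x (inner (edges H))"
    unfolding S'.inner_def inner_def using ab by blast
  then have 2: "insert x V = verts H \<union> S'.inner (edges H)" using V by simp
  have C': "S'.chain a b = take (Suc i) (chain a b) @ x # drop (Suc i) (chain a b)"
    using i(1) by (simp add: S'.chain_def chain_def I'_def J_def)
  have new_edges: "consecutive_edges (chain a b) - {{u, v}} \<union> {{u, x}, {x, v}}
      \<subseteq> consecutive_edges (S'.chain a b)"
  proof -
    have "{{u, x}, {x, v}} = {{chain a b ! i, x}, {x, chain a b ! Suc i}}"
      using i(2) by (auto simp: doubleton_eq_iff)
    then show ?thesis using consecutive_edges_insert[OF i(1), of x] i(2) unfolding C' by simp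
  qed
  have "e \<in> S'.chain_edges" if e: "e \<in> E" "e \<noteq> {u, v}" for e
  proof -
    obtain c d where cd: "{c, d} \<in> edges H" "e \<in> consecutive_edges (chain c d)"
      using E e unfolding chain_edges_def by blast
    show ?thesis
    proof (cases "{c, d} = {a, b}")
      case True
      have "chain b a = rev (chain a b)" by (simp add: chain_def I_rev[OF ab])
      then have "consecutive_edges (chain c d) = consecutive_edges (chain a b)"
        using True by (auto simp: doubleton_eq_iff)
      then show ?thesis using cd new_edges e ab unfolding S'.chain_edges_def by blast
    next
      case False
      then have "S'.chain c d = chain c d" by (simp add: S'.chain_def chain_def same)
      then show ?thesis using cd unfolding S'.chain_edges_def
        by (intro CollectI exI[of _ c] exI[of _ d]) simp
    qed
  qed
  moreover have "{{u, x}, {x, v}} \<subseteq> S'.chain_edges"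
    using new_edges ab unfolding S'.chain_edges_def by blast
  ultimately have "(E - {{u, v}}) \<union> {{u, x}, {x, v}} \<subseteq> S'.chain_edges" by auto
  then show ?thesis by (rule that[OF seg' 2])
qed

lemma subdivision_segments:
  assumes "subdivision_of H H'" "simple_graph H"
  obtains I where "segments H I" "verts H' = verts H \<union> segments.inner I (edges H)"
    "edges H' \<subseteq> segments.chain_edges H I"
proof -
  have "\<exists>I. segments H I \<and> verts H' = verts H \<union> segments.inner I (edges H) \<and>
    edges H' \<subseteq> segments.chain_edges H I"
    using assms(1)
  proof (induction rule: subdivision_of.induct)
    case refl
    interpret segments H "\<lambda>_ _. []"
      using assms(2) by unfold_locales auto
    have "e \<in> chain_edges" if e: "e \<in> edges H" for e
    proof -
      obtain u v where "e = {u, v}" using e by (rule edge_cases)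
      then show ?thesis
        using e unfolding chain_edges_def chain_def by (intro CollectI exI[of _ u] exI[of _ v]) simp
    qed
    then show ?case
      using segments_axioms by (intro exI[of _ "\<lambda>_ _. []"]) (auto simp: inner_def)
  next
    case (step V E u v x)
    then obtain I where I: "segments H I" "V = verts H \<union> segments.inner I (edges H)"
      "E \<subseteq> segments.chain_edges H I" by auto
    show ?case using segments_step[OF I step.hyps(2,3)] by (metis fst_conv snd_conv)
  qed
  then show ?thesis using that by blast
qed

section \<open>Paths in a subdivision\<close>

text \<open>Edges of \<open>H'\<close> serve to see where a path can go next, hence the inclusion.
  Every vertex must have an edge because even an empty tail is assigned to one.\<close>

locale subdivided = segments +
  fixes H' :: "'a sgraph"
  assumes verts': "verts H' = verts H \<union> inner (edges H)"
    and edges': "edges H' \<subseteq> chain_edges"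
    and no_isolated: "v \<in> verts H \<Longrightarrow> \<exists>w. {v, w} \<in> edges H"
begin

abbreviation len :: "'a \<Rightarrow> 'a \<Rightarrow> nat" where "len u v \<equiv> length (I u v)"

lemma edge_sym: "{u, v} \<in> edges H \<Longrightarrow> {v, u} \<in> edges H"
  by (simp add: insert_commute)

lemma len_sym: "{u, v} \<in> edges H \<Longrightarrow> len v u = len u v"
  by (simp add: I_rev)

lemma set_I_sym: "{u, v} \<in> edges H \<Longrightarrow> set (I v u) = set (I u v)"
  by (simp add: I_rev)

lemma chain_rev: "{u, v} \<in> edges H \<Longrightarrow> chain v u = rev (chain u v)"
  by (simp add: chain_def I_rev)

lemma length_chain [simp]: "length (chain u v) = Suc (Suc (len u v))"
  by (simp add: chain_def)

lemma chain_0 [simp]: "chain u v ! 0 = u"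
  by (simp add: chain_def)

lemma chain_last [simp]: "chain u v ! Suc (len u v) = v"
  by (simp add: chain_def nth_append)

lemma chain_Suc: "i < len u v \<Longrightarrow> chain u v ! Suc i = I u v ! i"
  by (simp add: chain_def nth_append)

lemma chain_interior: "1 \<le> i \<Longrightarrow> i \<le> len u v \<Longrightarrow> chain u v ! i \<in> set (I u v)"
  using chain_Suc[of "i - 1" u v] by simp

lemma chain_sym:
  "{u, v} \<in> edges H \<Longrightarrow> i \<le> Suc (len u v) \<Longrightarrow> chain v u ! i = chain u v ! (Suc (len u v) - i)"
  by (simp add: chain_rev rev_nth)

lemma distinct_chain: "{u, v} \<in> edges H \<Longrightarrow> distinct (chain u v)"
  using edge_verts I_verts I_distinct edge_neq unfolding chain_def by fastforce

lemma chain_vertD: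
  assumes "{u, v} \<in> edges H" "chain u v ! i \<in> verts H" "i \<le> len u v"
  shows "i = 0"
proof (rule ccontr)
  assume "i \<noteq> 0"
  then have "chain u v ! i \<in> set (I u v)" using chain_interior assms(3) by simp
  then show False using I_verts assms(1,2) by blast
qed

text \<open>An interior vertex belongs to one edge of \<open>H\<close> only, which fixes the chain
  up to reversal; distinctness of the chain fixes the position, and reversal turns \<open>j\<close>
  into \<open>Suc (len a b) - j\<close>.\<close>

lemma chain_interior_eqD:
  assumes "{u, v} \<in> edges H" "{a, b} \<in> edges H" "chain u v ! i = chain a b ! j"
    "i \<le> len u v" "1 \<le> j" "j \<le> len a b"
  shows "(u, v) = (a, b) \<and> i = j \<or> (u, v) = (b, a) \<and> i = Suc (len a b) - j"
proof -
  have ab: "chain a b ! j \<in> set (I a b)" using chain_interior assms by simp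
  have "i \<noteq> 0"
  proof
    assume "i = 0"
    then have "u \<in> set (I a b)" using assms(3) ab by simp
    then show False using edge_verts[OF assms(1)] I_verts[OF assms(2)] by blast
  qed
  then have "chain u v ! i \<in> set (I u v)" using chain_interior assms(4) by simp
  then have "{u, v} = {a, b}" using I_disjoint[OF assms(1,2)] ab assms(3) by simp
  then consider "(u, v) = (a, b)" | "(u, v) = (b, a)" by (auto simp: doubleton_eq_iff)
  then show ?thesis
  proof cases
    case 1
    then show ?thesis
      using nth_eq_iff_index_eq[OF distinct_chain[OF assms(1)], of i j] assms by simp
  next
    case 2
    then have "chain a b ! (Suc (len a b) - i) = chain a b ! j"
      using chain_sym[OF assms(2), of i] assms(3,4) len_sym[OF assms(2)] by simp
    then have "Suc (len a b) - i = j"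
      using nth_eq_iff_index_eq[OF distinct_chain[OF assms(2)], of "Suc (len a b) - i" j] assms by simp
    then show ?thesis using 2 assms(4) len_sym[OF assms(2)] by auto
  qed
qed

text \<open>The chain is reversed if necessary, so that the step from \<open>h\<close> to
  \<open>z\<close> goes forward; this is how a path with head \<open>h\<close> is prolonged at the
  front.\<close>

lemma neighbour_in_chain:
  assumes "{z, h} \<in> edges H'"
  obtains u v i where "{u, v} \<in> edges H" "i \<le> len u v" "h = chain u v ! i" "z = chain u v ! Suc i"
proof -
  obtain u v where uv: "{u, v} \<in> edges H" "{z, h} \<in> consecutive_edges (chain u v)"
    using assms edges' unfolding chain_edges_def by blast
  then obtain i where i: "i \<le> len u v" "{z, h} = {chain u v ! i, chain u v ! Suc i}"
    unfolding consecutive_edges_def by (force simp: less_Suc_eq_le)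
  show ?thesis
  proof (cases "h = chain u v ! i")
    case True
    then have "z = chain u v ! Suc i" using i(2) by (auto simp: doubleton_eq_iff)
    then show ?thesis using that[OF uv(1) i(1)] True by simp
  next
    case False
    then have "h = chain u v ! Suc i" "z = chain u v ! i" using i(2) by (auto simp: doubleton_eq_iff)
    moreover have "chain v u ! (len u v - i) = chain u v ! Suc i"
      "chain v u ! Suc (len u v - i) = chain u v ! i"
      using chain_sym[OF uv(1)] i(1) by (simp_all add: Suc_diff_le)
    ultimately show ?thesis
      using that[OF edge_sym[OF uv(1)], of "len u v - i"] len_sym[OF uv(1)] by simp
  qed
qed

section \<open>Normal form of a path in a subdivision\<close>

fun expand :: "'a list \<Rightarrow> 'a list" where
  "expand [] = []"
| "expand [a] = [a]"
| "expand (a # b # p) = a # I a b @ expand (b # p)"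

lemma hd_expand: "p \<noteq> [] \<Longrightarrow> hd (expand p) = hd p"
  by (induction p rule: expand.induct) auto

lemma expand_ne: "p \<noteq> [] \<Longrightarrow> expand p \<noteq> []"
  by (induction p rule: expand.induct) auto

lemma expand_Cons: "p \<noteq> [] \<Longrightarrow> expand (a # p) = a # I a (hd p) @ expand p"
  by (cases p) auto

lemma set_subset_expand: "set p \<subseteq> set (expand p)"
  by (induction p rule: expand.induct) auto

lemma distinct_if_distinct_expand: "distinct (expand p) \<Longrightarrow> distinct p"
proof (induction p rule: expand.induct)
  case (3 a b p)
  then show ?case using set_subset_expand[of "b # p"] by auto
qed auto

lemma inner_insert:
  assumes "{a, b} \<in> edges H"
  shows "inner (insert {a, b} F) = set (I a b) \<union> inner F"
  using set_I_sym[OF assms] unfolding inner_def by (auto simp: doubleton_eq_iff)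

lemma set_expand:
  "consecutive_edges p \<subseteq> edges H \<Longrightarrow> set (expand p) = set p \<union> inner (consecutive_edges p)"
proof (induction p rule: expand.induct)
  case (3 a b p)
  then show ?case by (auto simp: inner_insert)
qed (auto simp: inner_def)

definition walk :: "'a list \<Rightarrow> bool" where
  "walk p \<longleftrightarrow> p \<noteq> [] \<and> set p \<subseteq> verts H \<and> consecutive_edges p \<subseteq> edges H"

definition internal_path :: "'a list \<Rightarrow> bool" where
  "internal_path q \<longleftrightarrow> (\<exists>u v i n. {u, v} \<in> edges H \<and> 0 < n \<and> i + n \<le> len u v \<and>
     q = take n (drop i (I u v)))"

text \<open>A tail may fill the interior of its edge but not reach the far end: once
  \<open>a\<close> is reached, the whole edge is absorbed into \<open>p\<close>. An edge is named
  even for an empty tail.\<close>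

definition tailed_path :: "'a list \<Rightarrow> bool" where
  "tailed_path q \<longleftrightarrow> (\<exists>p a d x y. walk p \<and> {hd p, a} \<in> edges H \<and> {last p, d} \<in> edges H \<and>
     x \<le> len (hd p) a \<and> y \<le> len (last p) d \<and>
     q = rev (take x (I (hd p) a)) @ expand p @ take y (I (last p) d))"

lemma internal_path_Cons:
  assumes "internal_path q" "{z, hd q} \<in> edges H'" "z \<notin> set q"
  shows "internal_path (z # q) \<or> tailed_path (z # q)"
proof -
  obtain u v i n where uv: "{u, v} \<in> edges H" and n: "0 < n" "i + n \<le> len u v"
    and q: "q = take n (drop i (I u v))"
    using assms(1) by (auto simp: internal_path_def)
  have hd: "hd q = chain u v ! Suc i"
    using n q by (simp add: hd_drop_conv_nth chain_Suc)
  obtain u' v' j where j: "{u', v'} \<in> edges H" "j \<le> len u' v'" "hd q = chain u' v' ! j"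
    "z = chain u' v' ! Suc j"
    using neighbour_in_chain[OF assms(2)] by metis
  \<comment> \<open>The chain can be directed so that \<open>z\<close> immediately precedes
    \<open>q\<close>. If \<open>z\<close> lies on the other side, \<open>q\<close> has a single
    vertex, since its second entry would be \<open>z\<close>, and the chain may be reversed.\<close>
  have "\<exists>u v i. {u, v} \<in> edges H \<and> i + n \<le> len u v \<and> q = take n (drop i (I u v)) \<and> z = chain u v ! i"
  proof -
    consider "(u', v') = (u, v)" "j = Suc i" | "(u', v') = (v, u)" "j = len u v - i"
      using chain_interior_eqD[OF j(1) uv, of j "Suc i"] j hd n by auto
    then show ?thesis
    proof cases
      case 1
      then have z: "z = chain u v ! Suc (Suc i)" using j by simp
      have "n = 1"
      proof (rule ccontr)
        assume "n \<noteq> 1"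
        then have "z = q ! 1" "1 < length q" using n q z chain_Suc by auto
        then show False using assms(3) nth_mem by blast
      qed
      have i: "i < len u v" using n by simp
      then have q': "q = [I u v ! i]" using q \<open>n = 1\<close> by (simp add: take_Suc hd_drop_conv_nth)
      let ?i = "len u v - Suc i"
      have "I v u ! ?i = I u v ! i" using i by (simp add: I_rev[OF uv] rev_nth)
      then have "q = take n (drop ?i (I v u))"
        using i q' \<open>n = 1\<close> len_sym[OF uv] by (simp add: take_Suc hd_drop_conv_nth)
      moreover have "z = chain v u ! ?i" using z i chain_sym[OF uv, of ?i] by simp
      ultimately show ?thesis
        using edge_sym[OF uv] i \<open>n = 1\<close> len_sym[OF uv] by (intro exI[of _ v] exI[of _ u] exI[of _ ?i]) simp
    next
      case 2
      then have "z = chain u v ! i" using j n chain_sym[OF uv, of "Suc (len u v - i)"] by simp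
      then show ?thesis using uv n q by blast
    qed
  qed
  then obtain u v i where uv: "{u, v} \<in> edges H" and i: "i + n \<le> len u v"
    and q: "q = take n (drop i (I u v))" and z: "z = chain u v ! i" by blast
  show ?thesis
  proof (cases i)
    case 0
    have "walk [u]" using edge_verts[OF uv] by (simp add: walk_def)
    moreover have "z # q = rev (take 0 (I (hd [u]) v)) @ expand [u] @ take n (I (last [u]) v)"
      using 0 q z by simp
    ultimately have "tailed_path (z # q)"
      unfolding tailed_path_def using uv i 0
      by (intro exI[of _ "[u]"] exI[of _ v] exI[of _ 0] exI[of _ n]) simp
    then show ?thesis ..
  next
    case (Suc k)
    then have "z = I u v ! k" using z i n chain_Suc by simp
    then have "z # q = take (Suc n) (drop k (I u v))"
      using q Suc i n by (simp add: Cons_nth_drop_Suc[symmetric])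
    then have "internal_path (z # q)"
      unfolding internal_path_def using uv i Suc
      by (intro exI[of _ u] exI[of _ v] exI[of _ k] exI[of _ "Suc n"]) simp
    then show ?thesis ..
  qed
qed

lemma tailed_path_Cons:
  assumes "tailed_path q" "{z, hd q} \<in> edges H'" "z \<notin> set q"
  shows "tailed_path (z # q)"
proof -
  obtain p a d x y where p: "walk p" and a: "{hd p, a} \<in> edges H" and d: "{last p, d} \<in> edges H"
    and x: "x \<le> len (hd p) a" and y: "y \<le> len (last p) d"
    and q: "q = rev (take x (I (hd p) a)) @ expand p @ take y (I (last p) d)"
    using assms(1) unfolding tailed_path_def by blast
  define b r where "b = hd p" and "r = expand p @ take y (I (last p) d)"
  have pne: "p \<noteq> []" and bH: "b \<in> verts H" using p by (auto simp: walk_def b_def)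
  have b: "b = hd r" "b \<in> set r"
    using hd_expand[OF pne] expand_ne[OF pne] set_subset_expand[of p] pne by (auto simp: r_def b_def)
  obtain u v j where j: "{u, v} \<in> edges H" "j \<le> len u v" "hd q = chain u v ! j" "z = chain u v ! Suc j"
    using neighbour_in_chain[OF assms(2)] by metis
  \<comment> \<open>An empty tail lets \<open>a\<close> be replaced by the direction in which
    \<open>z\<close> lies. A nonempty tail can only continue outwards, since the next vertex inwards
    is already in \<open>q\<close>.\<close>
  have "\<exists>a x. {b, a} \<in> edges H \<and> x \<le> len b a \<and> q = rev (take x (I b a)) @ r \<and> z = chain b a ! Suc x"
  proof (cases x)
    case 0
    then have "hd q = b" "q = r" using q b by (simp_all add: r_def)
    then have "j = 0" using chain_vertD[OF j(1), of j] j bH by simp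
    then have "u = b" using j \<open>hd q = b\<close> by simp
    then show ?thesis using j \<open>q = r\<close> \<open>j = 0\<close> by (intro exI[of _ v] exI[of _ 0]) simp
  next
    case (Suc k)
    have k: "k < len b a" using x Suc by (simp add: b_def)
    then have q': "q = I b a ! k # rev (take k (I b a)) @ r"
      using q Suc by (simp add: r_def b_def take_Suc_conv_app_nth)
    then have "chain u v ! j = chain b a ! Suc k" using j chain_Suc k by simp
    then consider "(u, v) = (b, a)" "j = Suc k" | "(u, v) = (a, b)" "j = len b a - k"
      using chain_interior_eqD[OF j(1) a[folded b_def], of j "Suc k"] j k by auto
    then show ?thesis
    proof cases
      case 1
      then show ?thesis using j q x Suc a by (intro exI[of _ a] exI[of _ x]) (simp add: r_def b_def)
    next
      case 2
      then have z: "z = chain b a ! k"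
        using j k chain_sym[OF a[folded b_def], of "Suc (len b a - k)"] by simp
      have "z \<in> set q"
      proof (cases k)
        case 0
        then show ?thesis using z b q' by simp
      next
        case (Suc l)
        then have "z = take k (I b a) ! l" "l < length (take k (I b a))" using z k chain_Suc by simp_all
        then have "z \<in> set (take k (I b a))" using nth_mem by blast
        then show ?thesis using q' by simp
      qed
      then show ?thesis using assms(3) by simp
    qed
  qed
  then obtain a x where a: "{b, a} \<in> edges H" and x: "x \<le> len b a"
    and q: "q = rev (take x (I b a)) @ r" and z: "z = chain b a ! Suc x" by blast
  show ?thesis
  proof (cases "x < len b a")
    case True
    then have "z # q = rev (take (Suc x) (I b a)) @ r"
      using z q chain_Suc by (simp add: take_Suc_conv_app_nth)
    then show ?thesis
      unfolding tailed_path_def r_def b_def using p d y a True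
      by (intro exI[of _ p] exI[of _ a] exI[of _ d] exI[of _ "Suc x"] exI[of _ y]) (simp add: b_def)
  next
    case False
    \<comment> \<open>The tail is full and \<open>z\<close> is \<open>a\<close>. The edge joins the
      walk, and the new empty tail at \<open>a\<close> is assigned to the edge just
      traversed.\<close>
    then have "x = len b a" using x by simp
    then have "z # q = a # rev (I b a) @ r" using z q by simp
    also have "\<dots> = expand (a # p) @ take y (I (last p) d)"
      using expand_Cons[OF pne] I_rev[OF a] by (simp add: r_def b_def)
    finally have "z # q = rev (take 0 (I (hd (a # p)) b)) @ expand (a # p) @ take y (I (last (a # p)) d)"
      using pne by simp
    moreover have "walk (a # p)"
      using p a edge_verts[OF a] unfolding walk_def
      by (simp add: consecutive_edges_Cons b_def insert_commute)
    ultimately show ?thesis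
      unfolding tailed_path_def using d y edge_sym[OF a] pne
      by (intro exI[of _ "a # p"] exI[of _ b] exI[of _ d] exI[of _ 0] exI[of _ y]) simp
  qed
qed

lemma path_in_subdivision:
  assumes "q \<noteq> []" "distinct q" "set q \<subseteq> verts H'" "consecutive_edges q \<subseteq> edges H'"
  shows "internal_path q \<or> tailed_path q"
  using assms
proof (induction q rule: list_nonempty_induct)
  case (single z)
  show ?case
  proof (cases "z \<in> verts H")
    case True
    then obtain w where "{z, w} \<in> edges H" using no_isolated by blast
    then have "tailed_path [z]"
      unfolding tailed_path_def using True
      by (intro exI[of _ "[z]"] exI[of _ w] exI[of _ 0]) (simp add: walk_def)
    then show ?thesis ..
  next
    case False
    then obtain u v where uv: "{u, v} \<in> edges H" "z \<in> set (I u v)"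
      using single verts' unfolding inner_def by auto
    then obtain i where i: "i < len u v" "I u v ! i = z" by (metis in_set_conv_nth)
    then have "[z] = take 1 (drop i (I u v))" by (simp add: take_Suc hd_drop_conv_nth)
    then have "internal_path [z]" unfolding internal_path_def using uv i
      by (intro exI[of _ u] exI[of _ v] exI[of _ i] exI[of _ 1]) simp
    then show ?thesis ..
  qed
next
  case (cons z q)
  have "{z, hd q} \<in> edges H'" "z \<notin> set q"
    using cons by (auto simp: consecutive_edges_Cons)
  moreover have "internal_path q \<or> tailed_path q"
    using cons by (auto simp: consecutive_edges_Cons)
  ultimately show ?case using internal_path_Cons tailed_path_Cons by blast
qed

end

section \<open>Coordinates of the paths\<close>

definition list_graph :: "'a list \<Rightarrow> 'a sgraph" where
  "list_graph p = (set p, consecutive_edges p)"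

text \<open>Picks one of the two traversals of a path. The choice depends on
  \<open>list_graph p\<close> alone, so each subgraph is counted once.\<close>

definition canonical :: "'a list \<Rightarrow> bool" where
  "canonical p \<longleftrightarrow> (SOME q. q \<noteq> [] \<and> distinct q \<and> list_graph q = list_graph p) = p"

lemma canonical_or_rev:
  assumes "p \<noteq> []" "distinct p"
  shows "canonical p \<or> canonical (rev p)"
proof -
  define q where "q = (SOME q. q \<noteq> [] \<and> distinct q \<and> list_graph q = list_graph p)"
  have "q \<noteq> [] \<and> distinct q \<and> list_graph q = list_graph p"
    unfolding q_def by (rule someI[of _ p]) (use assms in simp)
  then have "q = p \<or> q = rev p"
    using path_list_unique[of p q] assms by (simp add: list_graph_def)
  moreover have "list_graph (rev p) = list_graph p" by (simp add: list_graph_def)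
  ultimately show ?thesis unfolding canonical_def q_def by metis
qed

lemma canonical_singleton: "canonical [s]"
  using canonical_or_rev[of "[s]"] by simp

lemma canonical_inj: "canonical p \<Longrightarrow> canonical q \<Longrightarrow> list_graph p = list_graph q \<Longrightarrow> p = q"
  unfolding canonical_def by metis

text \<open>The analogous choice of a direction for an edge, made from the set \<open>{u, v}\<close>
  alone; it keeps an edge from giving two classes of segments.\<close>

definition oriented :: "'a \<Rightarrow> 'a \<Rightarrow> bool" where
  "oriented u v \<longleftrightarrow> (SOME (x, y). {x, y} = {u, v}) = (u, v)"

lemma oriented_or_sym: "oriented u v \<or> oriented v u"
proof -
  obtain x y where e: "(SOME (x, y). {x, y} = {u, v}) = (x, y)" by fastforce
  have "case (SOME (x, y). {x, y} = {u, v}) of (x, y) \<Rightarrow> {x, y} = {u, v}"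
    by (rule someI[of _ "(u, v)"]) simp
  then have "(x, y) = (u, v) \<or> (x, y) = (v, u)" using e by (simp add: doubleton_eq_iff)
  moreover have "(SOME (x, y). {x, y} = {v, u}) = (x, y)"
    using e by (subst insert_commute[of v u])
  ultimately show ?thesis unfolding oriented_def using e by metis
qed

lemma oriented_inj:
  assumes "oriented u v" "oriented u' v'" "{u, v} = {u', v'}"
  shows "u = u' \<and> v = v'"
  using assms(1,2) unfolding oriented_def assms(3) by auto

context subdivided
begin

definition segment :: "'a \<Rightarrow> 'a \<Rightarrow> nat \<Rightarrow> nat \<Rightarrow> 'a set \<Rightarrow> bool" where
  "segment s t l r S \<longleftrightarrow> {s, t} \<in> edges H \<and> l \<le> r \<and> r \<le> Suc (len s t) \<and> S = (!) (chain s t) ` {l..r}"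

text \<open>The inequality excludes the paths that lie within a single subdivided edge, which are
  segments.\<close>

definition tailed :: "'a list \<Rightarrow> 'a \<Rightarrow> 'a \<Rightarrow> nat \<Rightarrow> nat \<Rightarrow> 'a set \<Rightarrow> bool" where
  "tailed p a d x y S \<longleftrightarrow> walk p \<and> distinct p \<and> {hd p, a} \<in> edges H \<and> {last p, d} \<in> edges H \<and>
     (hd p, a) \<noteq> (last p, d) \<and> x \<le> len (hd p) a \<and> y \<le> len (last p) d \<and>
     S = set p \<union> inner (consecutive_edges p) \<union>
       set (take x (I (hd p) a)) \<union> set (take y (I (last p) d))"

lemma set_sublist_I:
  assumes "i + n \<le> len u v"
  shows "set (take n (drop i (I u v))) = (!) (chain u v) ` {Suc i..i + n}"
proof -
  have "set (take n (drop i (I u v))) = (\<lambda>k. I u v ! (i + k)) ` {..<n}"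
  proof -
    have "take n (drop i (I u v)) = map (\<lambda>k. I u v ! (i + k)) [0..<n]"
      using assms by (intro nth_equalityI) auto
    then show ?thesis by (simp add: atLeast0LessThan)
  qed
  also have "\<dots> = (\<lambda>k. chain u v ! Suc (i + k)) ` {..<n}"
    using assms chain_Suc by (intro image_cong) auto
  also have "\<dots> = (!) (chain u v) ` (\<lambda>k. Suc (i + k)) ` {..<n}"
    by (simp add: image_image)
  also have "(\<lambda>k. Suc (i + k)) ` {..<n} = {Suc i..i + n}"
  proof -
    have "j \<in> (\<lambda>k. Suc (i + k)) ` {..<n}" if "j \<in> {Suc i..i + n}" for j
      using that by (intro image_eqI[of _ _ "j - Suc i"]) auto
    then show ?thesis by auto
  qed
  finally show ?thesis .
qed

lemma set_take_I: "n \<le> len u v \<Longrightarrow> set (take n (I u v)) = (!) (chain u v) ` {1..n}"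
  using set_sublist_I[of 0 n u v] by simp

lemma segment_sym:
  assumes "segment s t l r S"
  shows "segment t s (Suc (len s t) - r) (Suc (len s t) - l) S"
proof -
  have st: "{s, t} \<in> edges H" "l \<le> r" "r \<le> Suc (len s t)" using assms by (auto simp: segment_def)
  have "(\<lambda>i. Suc (len s t) - i) ` {Suc (len s t) - r..Suc (len s t) - l} = {l..r}"
  proof -
    have "j \<in> (\<lambda>i. Suc (len s t) - i) ` {Suc (len s t) - r..Suc (len s t) - l}" if "j \<in> {l..r}" for j
      using that st by (intro image_eqI[of _ _ "Suc (len s t) - j"]) auto
    then show ?thesis using st by auto
  qed
  then have "S = (!) (chain s t) ` (\<lambda>i. Suc (len s t) - i) ` {Suc (len s t) - r..Suc (len s t) - l}"
    using assms by (simp add: segment_def)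
  also have "\<dots> = (!) (chain t s) ` {Suc (len s t) - r..Suc (len s t) - l}"
    unfolding image_image by (intro image_cong) (use chain_sym[OF st(1)] in auto)
  finally show ?thesis
    using st edge_sym[OF st(1)] len_sym[OF st(1)] by (auto simp: segment_def)
qed

text \<open>Both descriptions can be read from either end, by \<open>segment_sym\<close> or by
  reversing \<open>p\<close> and exchanging the tails, so the chosen direction can always be
  attained.\<close>

lemma path_vertex_set_cases:
  assumes "S \<in> path_vertex_sets H'"
  shows "(\<exists>s t l r. oriented s t \<and> segment s t l r S) \<or>
    (\<exists>p a d x y. canonical p \<and> tailed p a d x y S)"
proof -
  have seg: ?thesis if "segment s t l r S" for s t l r
    using that segment_sym[OF that] oriented_or_sym[of s t] by blast
  obtain q where q: "q \<noteq> []" "distinct q" "set q \<subseteq> verts H'" "consecutive_edges q \<subseteq> edges H'"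
    and S: "S = set q"
    using assms by (auto simp: path_vertex_sets_def path_graph_def subgraph_of_def)
  show ?thesis
  proof (cases "internal_path q")
    case True
    then obtain u v i n where "{u, v} \<in> edges H" "0 < n" "i + n \<le> len u v"
      "q = take n (drop i (I u v))"
      by (auto simp: internal_path_def)
    then have "segment u v (Suc i) (i + n) S"
      using S set_sublist_I by (simp add: segment_def)
    then show ?thesis by (rule seg)
  next
    case False
    then obtain p a d x y where p: "walk p" and a: "{hd p, a} \<in> edges H"
      and d: "{last p, d} \<in> edges H" and xy: "x \<le> len (hd p) a" "y \<le> len (last p) d"
      and q_eq: "q = rev (take x (I (hd p) a)) @ expand p @ take y (I (last p) d)"
      using path_in_subdivision[OF q] unfolding tailed_path_def by blast
    have ne: "p \<noteq> []" using p by (simp add: walk_def)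
    have dist: "distinct p" using q(2) q_eq distinct_if_distinct_expand by simp
    have S_eq: "S = set p \<union> inner (consecutive_edges p) \<union>
       set (take x (I (hd p) a)) \<union> set (take y (I (last p) d))"
      using S q_eq set_expand[of p] p by (auto simp: walk_def)
    show ?thesis
    proof (cases "(hd p, a) = (last p, d)")
      case True
      then obtain b where b: "p = [b]"
        using dist ne by (cases p) (auto split: if_splits)
      \<comment> \<open>Both tails are initial parts of the same list, so their union is the longer
        one.\<close>
      define n where "n = max x y"
      have n: "n \<le> len b a" using xy True b by (simp add: n_def)
      have "set (take x (I b a)) \<union> set (take y (I b a)) = set (take n (I b a))"
        by (simp add: n_def max_def sup.absorb1 sup.absorb2 set_take_subset_set_take)
      then have "S = insert b (set (take n (I b a)))"
        using S_eq True b by (simp add: inner_def)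
      also have "\<dots> = (!) (chain b a) ` {0..n}"
        using set_take_I[OF n] by (simp add: atLeast0_atMost_Suc_eq_insert_0 image_insert
            Icc_eq_insert_lb_nat[of 0 n])
      finally have "segment b a 0 n S" using a b n by (simp add: segment_def)
      then show ?thesis by (rule seg)
    next
      case False
      then have "tailed p a d x y S"
        using p dist a d xy S_eq by (simp add: tailed_def)
      moreover have "tailed (rev p) d a y x S"
        using p dist a d xy S_eq False ne
        by (auto simp: tailed_def walk_def hd_rev last_rev)
      ultimately show ?thesis using canonical_or_rev[OF ne dist] by blast
    qed
  qed
qed

lemma tailed_mono:
  assumes "tailed p a d x y S" "tailed p a d x' y' S'" "x \<le> x'" "y \<le> y'"
  shows "S \<subseteq> S'"
  using assms set_take_subset_set_take[of x x' "I (hd p) a"] set_take_subset_set_take[of y y' "I (last p) d"]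
  unfolding tailed_def by blast

lemma segment_mono:
  assumes "segment s t l r S" "segment s t l' r' S'" "l' \<le> l" "r \<le> r'"
  shows "S \<subseteq> S'"
  using assms unfolding segment_def by auto

section \<open>Intersections in terms of coordinates\<close>

lemma interior_in_inner_iff:
  assumes "{s, t} \<in> edges H" "F \<subseteq> edges H" "1 \<le> i" "i \<le> len s t"
  shows "chain s t ! i \<in> inner F \<longleftrightarrow> {s, t} \<in> F"
proof
  assume "chain s t ! i \<in> inner F"
  then obtain u v where uv: "{u, v} \<in> F" "chain s t ! i \<in> set (I u v)" by (auto simp: inner_def)
  then have "{s, t} = {u, v}"
    using I_disjoint[OF assms(1) _ chain_interior[OF assms(3,4)], of u v] assms(2) by auto
  then show "{s, t} \<in> F" using uv by simp
next
  assume "{s, t} \<in> F"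
  then show "chain s t ! i \<in> inner F" using chain_interior[OF assms(3,4)] by (auto simp: inner_def)
qed

lemma interior_in_tail_iff:
  assumes "{s, t} \<in> edges H" "{b, a} \<in> edges H" "x \<le> len b a" "1 \<le> i" "i \<le> len s t"
  shows "chain s t ! i \<in> set (take x (I b a)) \<longleftrightarrow>
    (s, t) = (b, a) \<and> i \<le> x \<or> (t, s) = (b, a) \<and> Suc (len s t) - i \<le> x"
proof
  assume "chain s t ! i \<in> set (take x (I b a))"
  then obtain j where j: "1 \<le> j" "j \<le> x" "chain s t ! i = chain b a ! j"
    using set_take_I[OF assms(3)] by auto
  then show "(s, t) = (b, a) \<and> i \<le> x \<or> (t, s) = (b, a) \<and> Suc (len s t) - i \<le> x"
    using chain_interior_eqD[OF assms(1,2), of i j] assms(3,5) len_sym[OF assms(1)] by auto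
next
  assume "(s, t) = (b, a) \<and> i \<le> x \<or> (t, s) = (b, a) \<and> Suc (len s t) - i \<le> x"
  then show "chain s t ! i \<in> set (take x (I b a))"
  proof
    assume "(s, t) = (b, a) \<and> i \<le> x"
    then show ?thesis using set_take_I[OF assms(3)] assms(4) by auto
  next
    assume *: "(t, s) = (b, a) \<and> Suc (len s t) - i \<le> x"
    then have "chain s t ! i = chain b a ! (Suc (len s t) - i)"
      using chain_sym[OF assms(2), of i] len_sym[OF assms(1)] assms(5) by simp
    then show ?thesis using * set_take_I[OF assms(3)] assms(5) by auto
  qed
qed

lemma tail_interior:
  assumes "{b, a} \<in> edges H" "x \<le> len b a" "z \<in> set (take x (I b a))"
  obtains i where "1 \<le> i" "i \<le> x" "i \<le> len b a" "z = chain b a ! i"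
  using assms set_take_I[OF assms(2)] by auto

text \<open>Tails from distinct vertices can share an interior vertex only by approaching each other
  on one edge; they then overlap as soon as their lengths together exceed its number of interior
  vertices.\<close>

lemma tails_meet_iff:
  assumes "{b, a} \<in> edges H" "{b', a'} \<in> edges H" "b \<noteq> b'" "x \<le> len b a" "x' \<le> len b' a'"
  shows "set (take x (I b a)) \<inter> set (take x' (I b' a')) \<noteq> {} \<longleftrightarrow>
    a = b' \<and> a' = b \<and> len b a < x + x'"
proof
  assume "set (take x (I b a)) \<inter> set (take x' (I b' a')) \<noteq> {}"
  then obtain z where z: "z \<in> set (take x (I b a))" "z \<in> set (take x' (I b' a'))" by blast
  obtain i where i: "1 \<le> i" "i \<le> x" "i \<le> len b a" "z = chain b a ! i"
    using tail_interior[OF assms(1,4) z(1)] .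
  then show "a = b' \<and> a' = b \<and> len b a < x + x'"
    using interior_in_tail_iff[OF assms(1,2,5) i(1,3)] z(2) assms(3) by auto
next
  assume *: "a = b' \<and> a' = b \<and> len b a < x + x'"
  \<comment> \<open>The witness is the outermost vertex of the first tail; that tail is nonempty
    because \<open>x'\<close> alone is at most \<open>len b a\<close>.\<close>
  then have "1 \<le> x" using assms(5) len_sym[OF assms(1)] by auto
  then have "chain b a ! x \<in> set (take x (I b a)) \<inter> set (take x' (I b' a'))"
    using interior_in_tail_iff[OF assms(1,2,5), of x] interior_in_tail_iff[OF assms(1,1,4), of x] * assms(4)
    by auto
  then show "set (take x (I b a)) \<inter> set (take x' (I b' a')) \<noteq> {}" by blast
qed

lemma tails_disjoint_iff:
  assumes "{b, a} \<in> edges H" "{b', a'} \<in> edges H" "b \<noteq> b'" "x \<le> len b a" "x' \<le> len b' a'"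
  shows "set (take x (I b a)) \<inter> set (take x' (I b' a')) = {} \<longleftrightarrow>
    (a = b' \<and> a' = b \<longrightarrow> x + x' \<le> len b a)"
  using tails_meet_iff[OF assms] by (meson not_le)

lemma inner_inter_verts: "F \<subseteq> edges H \<Longrightarrow> inner F \<inter> verts H = {}"
  using I_verts unfolding inner_def by fast

lemma tail_inter_verts: "{b, a} \<in> edges H \<Longrightarrow> set (take x (I b a)) \<inter> verts H = {}"
  using I_verts in_set_takeD by fast

text \<open>Vertices of the tail are interior to \<open>{b, a}\<close> only, and this is no edge of
  \<open>p\<close> because \<open>p\<close> avoids \<open>b\<close>.\<close>

lemma walk_disjoint_tail:
  assumes "walk p" "{b, a} \<in> edges H" "b \<notin> set p" "x \<le> len b a"
  shows "(set p \<union> inner (consecutive_edges p)) \<inter> set (take x (I b a)) = {}"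
proof -
  have "z \<notin> inner (consecutive_edges p)" if z: "z \<in> set (take x (I b a))" for z
  proof
    assume in_inner: "z \<in> inner (consecutive_edges p)"
    obtain i where i: "1 \<le> i" "i \<le> x" "i \<le> len b a" "z = chain b a ! i"
      using tail_interior[OF assms(2,4) z] .
    then have "{b, a} \<in> consecutive_edges p"
      using in_inner interior_in_inner_iff[OF assms(2) _ i(1,3)] assms(1) by (simp add: walk_def)
    then show False using consecutive_edges_subset assms(3) by blast
  qed
  then show ?thesis using tail_inter_verts[OF assms(2), of x] assms(1) by (auto simp: walk_def)
qed

lemma walks_disjoint:
  assumes "walk p" "walk q" "set p \<inter> set q = {}"
  shows "(set p \<union> inner (consecutive_edges p)) \<inter> (set q \<union> inner (consecutive_edges q)) = {}"
proof -
  have False if z: "z \<in> inner (consecutive_edges p)" "z \<in> inner (consecutive_edges q)" for z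
  proof -
    obtain u v u' v' where uv: "{u, v} \<in> consecutive_edges p" "z \<in> set (I u v)"
      "{u', v'} \<in> consecutive_edges q" "z \<in> set (I u' v')"
      using z by (auto simp: inner_def)
    then have "{u, v} = {u', v'}" using I_disjoint assms(1,2) unfolding walk_def by blast
    then have "u \<in> set p \<inter> set q"
      using uv(1,3) consecutive_edges_subset[of "{u, v}" p] consecutive_edges_subset[of "{u', v'}" q]
      by blast
    then show False using assms(3) by simp
  qed
  then show ?thesis
    using assms inner_inter_verts[of "consecutive_edges p"] inner_inter_verts[of "consecutive_edges q"]
    unfolding walk_def by blast
qed

text \<open>Disjoint walks have disjoint expansions, and no tail runs along an edge of the other
  walk. What remains are the four pairs of tails.\<close>

lemma tailed_tailed_disjoint_iff:
  assumes "tailed p a d x y S" "tailed p' a' d' x' y' S'" "set p \<inter> set p' = {}"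
  shows "S \<inter> S' = {} \<longleftrightarrow>
    (a = hd p' \<and> a' = hd p \<longrightarrow> x + x' \<le> len (hd p) a) \<and>
    (a = last p' \<and> d' = hd p \<longrightarrow> x + y' \<le> len (hd p) a) \<and>
    (d = hd p' \<and> a' = last p \<longrightarrow> y + x' \<le> len (last p) d) \<and>
    (d = last p' \<and> d' = last p \<longrightarrow> y + y' \<le> len (last p) d)"
proof -
  have ne: "p \<noteq> []" "p' \<noteq> []" using assms by (auto simp: tailed_def walk_def)
  then have neq: "hd p \<noteq> hd p'" "hd p \<noteq> last p'" "last p \<noteq> hd p'" "last p \<noteq> last p'"
    using assms(3) by (metis disjoint_iff hd_in_set last_in_set)+
  have notin: "hd p \<notin> set p'" "last p \<notin> set p'" "hd p' \<notin> set p" "last p' \<notin> set p"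
    using ne assms(3) by (metis disjoint_iff hd_in_set last_in_set)+
  define core t1 t2 core' t1' t2' where defs: "core = set p \<union> inner (consecutive_edges p)"
    "t1 = set (take x (I (hd p) a))" "t2 = set (take y (I (last p) d))"
    "core' = set p' \<union> inner (consecutive_edges p')"
    "t1' = set (take x' (I (hd p') a'))" "t2' = set (take y' (I (last p') d'))"
  have "S = core \<union> t1 \<union> t2" "S' = core' \<union> t1' \<union> t2'"
    using assms(1,2) by (auto simp: tailed_def defs)
  moreover have "core \<inter> core' = {}"
    using walks_disjoint assms unfolding defs tailed_def by simp
  moreover have "core \<inter> t1' = {}" "core \<inter> t2' = {}" "core' \<inter> t1 = {}" "core' \<inter> t2 = {}"
    unfolding defs using assms(1,2) notin by (intro walk_disjoint_tail; simp add: tailed_def)+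
  ultimately have "S \<inter> S' = {} \<longleftrightarrow>
      t1 \<inter> t1' = {} \<and> t1 \<inter> t2' = {} \<and> t2 \<inter> t1' = {} \<and> t2 \<inter> t2' = {}"
    by blast
  moreover have
    "t1 \<inter> t1' = {} \<longleftrightarrow> (a = hd p' \<and> a' = hd p \<longrightarrow> x + x' \<le> len (hd p) a)"
    "t1 \<inter> t2' = {} \<longleftrightarrow> (a = last p' \<and> d' = hd p \<longrightarrow> x + y' \<le> len (hd p) a)"
    "t2 \<inter> t1' = {} \<longleftrightarrow> (d = hd p' \<and> a' = last p \<longrightarrow> y + x' \<le> len (last p) d)"
    "t2 \<inter> t2' = {} \<longleftrightarrow> (d = last p' \<and> d' = last p \<longrightarrow> y + y' \<le> len (last p) d)"
    unfolding defs using assms(1,2) neq by (intro tails_disjoint_iff; simp add: tailed_def)+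
  ultimately show ?thesis by (simp only:)
qed

section \<open>Tailed paths against segments\<close>

text \<open>The last position on the chain from \<open>s\<close> to \<open>t\<close> that a tailed path covers starting
  from \<open>s\<close>; it is \<open>- 1\<close> if the path avoids \<open>s\<close>.\<close>

definition reach :: "'a list \<Rightarrow> 'a \<Rightarrow> 'a \<Rightarrow> nat \<Rightarrow> nat \<Rightarrow> 'a \<Rightarrow> 'a \<Rightarrow> int" where
  "reach p a d x y s t = (if s \<notin> set p then - 1 else if (hd p, a) = (s, t) then int x
     else if (last p, d) = (s, t) then int y else 0)"

lemma reach_le:
  assumes "tailed p a d x y S"
  shows "reach p a d x y s t \<le> int (len s t)"
  using assms by (auto simp: reach_def tailed_def)

lemma reach_mono:
  shows "(last p, d) \<noteq> (s, t) \<Longrightarrow> x \<le> x' \<Longrightarrow> reach p a d x y s t \<le> reach p a d x' y' s t"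
    and "(hd p, a) \<noteq> (s, t) \<Longrightarrow> y \<le> y' \<Longrightarrow> reach p a d x y s t \<le> reach p a d x' y' s t"
  by (auto simp: reach_def)

text \<open>As \<open>{s, t}\<close> is no edge of \<open>p\<close>, only the ends and the tails
  touch its chain: \<open>S\<close> covers an initial piece seen from \<open>s\<close> and an
  initial piece seen from \<open>t\<close>.\<close>

lemma in_tailed_iff:
  assumes "tailed p a d x y S" "{s, t} \<in> edges H" "{s, t} \<notin> consecutive_edges p" "i \<le> Suc (len s t)"
  shows "chain s t ! i \<in> S \<longleftrightarrow>
    int i \<le> reach p a d x y s t \<or> int (Suc (len s t) - i) \<le> reach p a d x y t s"
proof -
  have tl: "walk p" "{hd p, a} \<in> edges H" "{last p, d} \<in> edges H" "x \<le> len (hd p) a" "y \<le> len (last p) d"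
    "(hd p, a) \<noteq> (last p, d)"
    and S: "S = set p \<union> inner (consecutive_edges p) \<union>
       set (take x (I (hd p) a)) \<union> set (take y (I (last p) d))"
    using assms(1) by (auto simp: tailed_def)
  have ends: "hd p \<in> set p" "last p \<in> set p" and ce: "consecutive_edges p \<subseteq> edges H"
    and ps: "set p \<subseteq> verts H"
    using tl(1) by (auto simp: walk_def)
  have vert: "z \<in> S \<longleftrightarrow> z \<in> set p" if "z \<in> verts H" for z
    using that S inner_inter_verts[OF ce] tail_inter_verts[OF tl(2), of x]
      tail_inter_verts[OF tl(3), of y] by blast
  have reach0: "0 \<le> reach p a d x y u v \<longleftrightarrow> u \<in> set p" for u v
    by (auto simp: reach_def)
  \<comment> \<open>At an end of the chain only the reach from that end counts, because the other
    one is at most \<open>len s t\<close>.\<close>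
  note le = reach_le[OF assms(1), of s t] reach_le[OF assms(1), of t s] len_sym[OF assms(2)]
  consider "i = 0" | "i = Suc (len s t)" | "1 \<le> i" "i \<le> len s t" using assms(4) by linarith
  then show ?thesis
  proof cases
    case 1
    then show ?thesis using vert[of s] edge_verts[OF assms(2)] reach0[of s t] le by auto
  next
    case 2
    then show ?thesis using vert[of t] edge_verts[OF assms(2)] reach0[of t s] le by auto
  next
    case 3
    have "chain s t ! i \<notin> set p"
      using chain_vertD[OF assms(2), of i] 3 ps by auto
    then have "chain s t ! i \<in> S \<longleftrightarrow>
      ((s, t) = (hd p, a) \<and> i \<le> x \<or> (t, s) = (hd p, a) \<and> Suc (len s t) - i \<le> x) \<or>
      ((s, t) = (last p, d) \<and> i \<le> y \<or> (t, s) = (last p, d) \<and> Suc (len s t) - i \<le> y)"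
      unfolding S Un_iff
      using interior_in_inner_iff[OF assms(2) ce 3] assms(3)
        interior_in_tail_iff[OF assms(2) tl(2,4) 3] interior_in_tail_iff[OF assms(2) tl(3,5) 3]
      by blast
    also have "\<dots> \<longleftrightarrow>
      ((s, t) = (hd p, a) \<and> i \<le> x \<or> (s, t) = (last p, d) \<and> i \<le> y) \<or>
      ((t, s) = (hd p, a) \<and> Suc (len s t) - i \<le> x \<or> (t, s) = (last p, d) \<and> Suc (len s t) - i \<le> y)"
      by blast
    also have "((s, t) = (hd p, a) \<and> i \<le> x \<or> (s, t) = (last p, d) \<and> i \<le> y) \<longleftrightarrow>
        int i \<le> reach p a d x y s t"
      using ends tl(6) 3 by (auto simp: reach_def)
    also have "((t, s) = (hd p, a) \<and> Suc (len s t) - i \<le> x \<or>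
        (t, s) = (last p, d) \<and> Suc (len s t) - i \<le> y) \<longleftrightarrow>
        int (Suc (len s t) - i) \<le> reach p a d x y t s"
      using ends tl(6) 3 by (auto simp: reach_def)
    finally show ?thesis .
  qed
qed

lemma tailed_segment_disjoint_iff:
  assumes "tailed p a d x y S" "segment s t l r S'" "{s, t} \<notin> consecutive_edges p"
  shows "S \<inter> S' = {} \<longleftrightarrow> reach p a d x y s t \<le> int l - 1 \<and> reach p a d x y t s \<le> int (len s t) - int r"
proof -
  have st: "{s, t} \<in> edges H" "l \<le> r" "r \<le> Suc (len s t)" and S': "S' = (!) (chain s t) ` {l..r}"
    using assms(2) by (auto simp: segment_def)
  have "S \<inter> S' = {} \<longleftrightarrow> (\<forall>i\<in>{l..r}. chain s t ! i \<notin> S)" using S' by auto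
  also have "\<dots> \<longleftrightarrow> (\<forall>i\<in>{l..r}. reach p a d x y s t < int i \<and>
      reach p a d x y t s < int (Suc (len s t) - i))"
    using in_tailed_iff[OF assms(1) st(1) assms(3)] st by auto
  \<comment> \<open>Of the bounds over the interval, the first is tightest at \<open>l\<close> and
    the second at \<open>r\<close>.\<close>
  also have "\<dots> \<longleftrightarrow> reach p a d x y s t < int l \<and> reach p a d x y t s < int (Suc (len s t) - r)"
    using st by (auto simp: of_nat_diff)
  also have "\<dots> \<longleftrightarrow> reach p a d x y s t \<le> int l - 1 \<and> reach p a d x y t s \<le> int (len s t) - int r"
    using st by auto
  finally show ?thesis .
qed

text \<open>The chain of an edge of \<open>p\<close> is covered completely, so already the first
  vertex of the segment is shared.\<close>

lemma tailed_segment_meet: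
  assumes "tailed p a d x y S" "segment s t l r S'" "{s, t} \<in> consecutive_edges p"
  shows "S \<inter> S' \<noteq> {}"
proof -
  have st: "{s, t} \<in> edges H" "l \<le> r" "r \<le> Suc (len s t)" and S': "S' = (!) (chain s t) ` {l..r}"
    using assms(2) by (auto simp: segment_def)
  have ce: "consecutive_edges p \<subseteq> edges H" using assms(1) by (simp add: tailed_def walk_def)
  have ends: "s \<in> set p" "t \<in> set p" using consecutive_edges_subset[OF assms(3)] by auto
  consider "l = 0" | "l = Suc (len s t)" | "1 \<le> l" "l \<le> len s t" using st by linarith
  then have "chain s t ! l \<in> set p \<union> inner (consecutive_edges p)"
    using ends interior_in_inner_iff[OF st(1) ce] assms(3) by cases auto
  then have "chain s t ! l \<in> S" using assms(1) by (auto simp: tailed_def)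
  then show ?thesis using S' st(2) by auto
qed

section \<open>Segments against segments\<close>

lemma segment_segment_same_iff:
  assumes "segment s t l r S" "segment s t l' r' S'"
  shows "S \<inter> S' \<noteq> {} \<longleftrightarrow> l \<le> r' \<and> l' \<le> r"
proof -
  have st: "{s, t} \<in> edges H" "l \<le> r" "r \<le> Suc (len s t)" "l' \<le> r'" "r' \<le> Suc (len s t)"
    and S: "S = (!) (chain s t) ` {l..r}" "S' = (!) (chain s t) ` {l'..r'}"
    using assms by (auto simp: segment_def)
  have "inj_on ((!) (chain s t)) ({l..r} \<union> {l'..r'})"
    using distinct_chain[OF st(1)] st by (intro inj_on_nth) auto
  then have "S \<inter> S' = (!) (chain s t) ` ({l..r} \<inter> {l'..r'})"
    unfolding S by (rule inj_on_image_Int[symmetric]) auto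
  also have "\<dots> \<noteq> {} \<longleftrightarrow> l \<le> r' \<and> l' \<le> r" using st(2,4) by auto
  finally show ?thesis .
qed

text \<open>Nonpositive iff the segment contains the end \<open>z\<close> of its chain.\<close>

definition gap :: "'a \<Rightarrow> 'a \<Rightarrow> nat \<Rightarrow> nat \<Rightarrow> 'a \<Rightarrow> int" where
  "gap s t l r z = (if z = s then int l else int (Suc (len s t)) - int r)"

lemma end_in_segment_iff:
  assumes "segment s t l r S" "z \<in> {s, t}"
  shows "z \<in> S \<longleftrightarrow> gap s t l r z = 0" "gap s t l r z \<ge> 0"
proof -
  have st: "{s, t} \<in> edges H" "l \<le> r" "r \<le> Suc (len s t)" using assms by (auto simp: segment_def)
  \<comment> \<open>Containing an end amounts to meeting the one-vertex segment there.\<close>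
  have "segment s t 0 0 {s}" "segment s t (Suc (len s t)) (Suc (len s t)) {t}"
    using st by (auto simp: segment_def)
  then have "s \<in> S \<longleftrightarrow> l = 0" "t \<in> S \<longleftrightarrow> r = Suc (len s t)"
    using segment_segment_same_iff[OF assms(1)] st by fastforce+
  then show "z \<in> S \<longleftrightarrow> gap s t l r z = 0" "gap s t l r z \<ge> 0"
    using assms(2) st edge_neq[OF st(1)] by (auto simp: gap_def)
qed

lemma segments_meet_at_ends:
  assumes "segment s t l r S" "segment s' t' l' r' S'" "{s, t} \<noteq> {s', t'}" "z \<in> S" "z \<in> S'"
  shows "z \<in> {s, t} \<inter> {s', t'}"
proof -
  have st: "{s, t} \<in> edges H" "{s', t'} \<in> edges H" using assms by (auto simp: segment_def)
  have "S \<subseteq> set (chain s t)" "S' \<subseteq> set (chain s' t')"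
    using assms(1,2) by (auto simp: segment_def intro!: nth_mem)
  then have "z \<in> {s, t} \<union> set (I s t)" "z \<in> {s', t'} \<union> set (I s' t')"
    using assms(4,5) by (auto simp: chain_def)
  then show ?thesis
    using I_disjoint[OF st, of z] assms(3) I_verts[OF st(1)] I_verts[OF st(2)]
      edge_verts[OF st(1)] edge_verts[OF st(2)] by auto
qed

end

section \<open>Compatibility of the classes\<close>

lemma finite_subgraphs:
  assumes "simple_graph H"
  shows "finite {P. subgraph_of P H \<and> Q P}"
proof -
  have "finite (verts H)" "finite (edges H)"
    using assms finite_imp_finite_nsets finite_subset unfolding simple_graph_def by blast+
  moreover have "{P. subgraph_of P H \<and> Q P} \<subseteq> Pow (verts H) \<times> Pow (edges H)"
    by (auto simp: subgraph_of_def)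
  ultimately show ?thesis by (meson finite_Pow_iff finite_SigmaI finite_subset)
qed

locale path_intersection_graph = subdivided H I H'
  for H :: "'a sgraph" and I H' +
  fixes G :: "'v sgraph" and S :: "'v \<Rightarrow> 'a set"
  assumes intersection: "intersection_graph_of G S"
begin

lemma edge_iff:
  assumes "u \<in> verts G" "v \<in> verts G" "u \<noteq> v"
  shows "{u, v} \<in> edges G \<longleftrightarrow> S u \<inter> S v \<noteq> {}"
proof
  assume "{u, v} \<in> edges G"
  then obtain u' v' where "{u, v} = {u', v'}" "S u' \<inter> S v' \<noteq> {}"
    using intersection unfolding intersection_graph_of_def by auto
  then show "S u \<inter> S v \<noteq> {}" by (auto simp: doubleton_eq_iff)
next
  assume "S u \<inter> S v \<noteq> {}"
  then show "{u, v} \<in> edges G"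
    using assms intersection unfolding intersection_graph_of_def by auto
qed

lemma non_edge_iff:
  assumes "u \<in> verts G" "v \<in> verts G" "u \<noteq> v"
  shows "{u, v} \<in> [verts G]\<^bsup>2\<^esup> - edges G \<longleftrightarrow> S u \<inter> S v = {}"
  using edge_iff[OF assms] assms by (simp add: nsets_def)

lemma compatible_if_disjoint_iff:
  assumes "A \<subseteq> verts G" "B \<subseteq> verts G" "A \<inter> B = {}" "inj_on \<rho> A" "inj_on \<rho> B"
    and "opposed \<rho> A x y \<or> opposed \<rho> A y x" "opposed \<rho> B X Y \<or> opposed \<rho> B Y X"
    and "\<And>u w. u \<in> A \<Longrightarrow> w \<in> B \<Longrightarrow> S u \<inter> S w = {} \<longleftrightarrow> x u \<le> X w \<and> y u \<le> Y w"
  shows "compatible G \<rho> A B"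
proof (rule compatible_if_opposed[OF assms(3-7)])
  fix u w assume uw: "u \<in> A" "w \<in> B"
  then have "u \<in> verts G" "w \<in> verts G" "u \<noteq> w" using assms(1-3) by auto
  then show "{u, w} \<in> [verts G]\<^bsup>2\<^esup> - edges G \<longleftrightarrow> x u \<le> X w \<and> y u \<le> Y w"
    using non_edge_iff assms(8)[OF uw] by simp
qed simp

lemma compatible_if_meet:
  assumes "A \<subseteq> verts G" "B \<subseteq> verts G" "A \<inter> B = {}" "inj_on \<rho> A" "inj_on \<rho> B"
    and "\<And>u w. u \<in> A \<Longrightarrow> w \<in> B \<Longrightarrow> S u \<inter> S w \<noteq> {}"
  shows "compatible G \<rho> A B"
  using assms
  \<comment> \<open>The inequality \<open>1 \<le> 0\<close> never holds: there are no disjoint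
    pairs.\<close>
  by (intro compatible_if_disjoint_iff[where x = "\<lambda>_. 1" and y = "\<lambda>_. 0" and X = "\<lambda>_. 0" and Y = "\<lambda>_. 0"])
    (auto simp: opposed_def)

text \<open>Two tails of one path that both met the same tail would leave the same vertex along the
  same edge, which \<open>tailed\<close> excludes. So the four conditions form a matching, straight
  (\<open>x\<close> with \<open>x\<close>, \<open>y\<close> with \<open>y\<close>) or crossed, and
  each coordinate occurs in at most one of them.\<close>

lemma compatible_tailed_tailed:
  assumes AB: "A \<subseteq> verts G" "B \<subseteq> verts G" "A \<inter> B = {}" and inj: "inj_on \<rho> A" "inj_on \<rho> B"
    and opA: "opposed \<rho> A (int \<circ> x) (int \<circ> y)" and opB: "opposed \<rho> B (int \<circ> x) (int \<circ> y)"
    and A: "\<And>u. u \<in> A \<Longrightarrow> tailed p a d (x u) (y u) (S u)"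
    and B: "\<And>w. w \<in> B \<Longrightarrow> tailed p' a' d' (x w) (y w) (S w)"
  shows "compatible G \<rho> A B"
proof (cases "set p \<inter> set p' = {}")
  case False
  then have "S u \<inter> S w \<noteq> {}" if "u \<in> A" "w \<in> B" for u w
    using A[OF that(1)] B[OF that(2)] unfolding tailed_def by blast
  then show ?thesis by (rule compatible_if_meet[OF AB inj])
next
  case True
  define b c b' c' where ends: "b = hd p" "c = last p" "b' = hd p'" "c' = last p'"
  have iff: "S u \<inter> S w = {} \<longleftrightarrow>
      (a = b' \<and> a' = b \<longrightarrow> x u + x w \<le> len b a) \<and> (a = c' \<and> d' = b \<longrightarrow> x u + y w \<le> len b a) \<and>
      (d = b' \<and> a' = c \<longrightarrow> y u + x w \<le> len c d) \<and> (d = c' \<and> d' = c \<longrightarrow> y u + y w \<le> len c d)"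
    if "u \<in> A" "w \<in> B" for u w
    unfolding ends by (rule tailed_tailed_disjoint_iff[OF A[OF that(1)] B[OF that(2)] True])
  \<comment> \<open>Separates the two paths in a conditional inequality; an absent condition becomes
    \<open>0 \<le> 0\<close>.\<close>
  have conv: "(if P then int i else 0) \<le> (if P then int l - int j else 0) \<longleftrightarrow> (P \<longrightarrow> i + j \<le> l)"
    for P i j l by auto
  show ?thesis
  proof (cases "A = {} \<or> B = {}")
    case True
    then show ?thesis
      using compatible_if_meet[OF AB inj] by blast
  next
    case False
    then obtain u w where "u \<in> A" "w \<in> B" by blast
    then have neq: "(b, a) \<noteq> (c, d)" "(b', a') \<noteq> (c', d')"
      using A B unfolding ends tailed_def by blast+
    show ?thesis
    proof (cases "(a = c' \<and> d' = b) \<or> (d = b' \<and> a' = c)")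
      case True
      then have no: "\<not> (a = b' \<and> a' = b)" "\<not> (d = c' \<and> d' = c)" using neq by auto
      show ?thesis
      proof (rule compatible_if_disjoint_iff[OF AB inj])
        show "S u \<inter> S w = {} \<longleftrightarrow>
          (if a = c' \<and> d' = b then int (x u) else 0) \<le> (if a = c' \<and> d' = b then int (len b a) - int (y w) else 0) \<and>
          (if d = b' \<and> a' = c then int (y u) else 0) \<le> (if d = b' \<and> a' = c then int (len c d) - int (x w) else 0)"
          if "u \<in> A" "w \<in> B" for u w
          unfolding iff[OF that] conv using no by blast
      qed (use opA opB in \<open>auto simp: opposed_def\<close>)
    next
      case False
      show ?thesis
      proof (rule compatible_if_disjoint_iff[OF AB inj])
        show "S u \<inter> S w = {} \<longleftrightarrow>
          (if a = b' \<and> a' = b then int (x u) else 0) \<le> (if a = b' \<and> a' = b then int (len b a) - int (x w) else 0) \<and>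
          (if d = c' \<and> d' = c then int (y u) else 0) \<le> (if d = c' \<and> d' = c then int (len c d) - int (y w) else 0)"
          if "u \<in> A" "w \<in> B" for u w
          unfolding iff[OF that] conv using False by blast
      qed (use opA opB in \<open>auto simp: opposed_def\<close>)
    qed
  qed
qed

text \<open>If both tails run on the chain of \<open>{s, t}\<close>, they come from opposite ends.
  Hence each reach depends on at most one coordinate, and the two never on the same one, which makes
  them opposed on \<open>A\<close>.\<close>

lemma compatible_tailed_segment:
  assumes AB: "A \<subseteq> verts G" "B \<subseteq> verts G" "A \<inter> B = {}" and inj: "inj_on \<rho> A" "inj_on \<rho> B"
    and opA: "opposed \<rho> A (int \<circ> x) (int \<circ> y)" and opB: "opposed \<rho> B (int \<circ> x) (\<lambda>w. - int (y w))"
    and A: "\<And>u. u \<in> A \<Longrightarrow> tailed p a d (x u) (y u) (S u)"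
    and B: "\<And>w. w \<in> B \<Longrightarrow> segment s t (x w) (y w) (S w)"
  shows "compatible G \<rho> A B"
proof (cases "{s, t} \<in> consecutive_edges p \<or> A = {} \<or> B = {}")
  case True
  then have "S u \<inter> S w \<noteq> {}" if "u \<in> A" "w \<in> B" for u w
    using tailed_segment_meet[OF A[OF that(1)] B[OF that(2)]] that by blast
  then show ?thesis by (rule compatible_if_meet[OF AB inj])
next
  case False
  then obtain u w where "u \<in> A" "w \<in> B" by blast
  then have neq: "(hd p, a) \<noteq> (last p, d)" and st: "s \<noteq> t"
    using A B edge_neq unfolding tailed_def segment_def by blast+
  show ?thesis
  proof (rule compatible_if_disjoint_iff[OF AB inj])
    show "S u \<inter> S w = {} \<longleftrightarrow> reach p a d (x u) (y u) s t \<le> int (x w) - 1 \<and>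
        reach p a d (x u) (y u) t s \<le> int (len s t) - int (y w)" if "u \<in> A" "w \<in> B" for u w
      using tailed_segment_disjoint_iff[OF A[OF that(1)] B[OF that(2)]] False by blast
    show "opposed \<rho> B (\<lambda>w. int (x w) - 1) (\<lambda>w. int (len s t) - int (y w)) \<or>
        opposed \<rho> B (\<lambda>w. int (len s t) - int (y w)) (\<lambda>w. int (x w) - 1)"
    proof (intro disjI1)
      show "opposed \<rho> B (\<lambda>w. int (x w) - 1) (\<lambda>w. int (len s t) - int (y w))"
        using opB unfolding opposed_def by fastforce
    qed
    show "opposed \<rho> A (\<lambda>u. reach p a d (x u) (y u) s t) (\<lambda>u. reach p a d (x u) (y u) t s) \<or>
        opposed \<rho> A (\<lambda>u. reach p a d (x u) (y u) t s) (\<lambda>u. reach p a d (x u) (y u) s t)"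
    proof (cases "(hd p, a) = (s, t) \<or> (last p, d) = (t, s)")
      case True
      then have "(last p, d) \<noteq> (s, t)" "(hd p, a) \<noteq> (t, s)" using neq st by auto
      then have "opposed \<rho> A (\<lambda>u. reach p a d (x u) (y u) s t) (\<lambda>u. reach p a d (x u) (y u) t s)"
        using opA unfolding opposed_def comp_def of_nat_le_iff by (blast intro: reach_mono)
      then show ?thesis ..
    next
      case False
      then have "(last p, d) \<noteq> (t, s)" "(hd p, a) \<noteq> (s, t)" by auto
      then have "opposed \<rho> A (\<lambda>u. reach p a d (x u) (y u) t s) (\<lambda>u. reach p a d (x u) (y u) s t)"
        using opA unfolding opposed_def comp_def of_nat_le_iff by (blast intro: reach_mono)
      then show ?thesis ..
    qed
  qed
qed

text \<open>Distinct edges share at most one vertex \<open>z\<close>, and two segments meet iff both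
  gaps at \<open>z\<close> vanish. Disjointness would be a disjunction, so \<open>edges G\<close> is
  used here: gaps are nonnegative, hence one inequality says that both are 0.\<close>

lemma compatible_segment_segment:
  assumes AB: "A \<subseteq> verts G" "B \<subseteq> verts G" "A \<inter> B = {}" and inj: "inj_on \<rho> A" "inj_on \<rho> B"
    and opA: "opposed \<rho> A (int \<circ> x) (\<lambda>w. - int (y w))" and opB: "opposed \<rho> B (int \<circ> x) (\<lambda>w. - int (y w))"
    and A: "\<And>u. u \<in> A \<Longrightarrow> segment s t (x u) (y u) (S u)"
    and B: "\<And>w. w \<in> B \<Longrightarrow> segment s' t' (x w) (y w) (S w)"
    and neq: "{s, t} \<noteq> {s', t'}"
  shows "compatible G \<rho> A B"
proof (cases "{s, t} \<inter> {s', t'} = {}")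
  case True
  then have "S u \<inter> S w = {}" if "u \<in> A" "w \<in> B" for u w
    using segments_meet_at_ends[OF A[OF that(1)] B[OF that(2)] neq] by blast
  then show ?thesis
    by (intro compatible_if_disjoint_iff[OF AB inj, where x = "\<lambda>_. 0" and y = "\<lambda>_. 0"
          and X = "\<lambda>_. 0" and Y = "\<lambda>_. 0"]) (auto simp: opposed_def)
next
  case False
  then obtain z where z: "z \<in> {s, t}" "z \<in> {s', t'}" by blast
  then have only: "z' = z" if "z' \<in> {s, t} \<inter> {s', t'}" for z'
    using that neq by auto
  have meet: "S u \<inter> S w \<noteq> {} \<longleftrightarrow> gap s t (x u) (y u) z \<le> - gap s' t' (x w) (y w) z"
    if uw: "u \<in> A" "w \<in> B" for u w
  proof -
    have "S u \<inter> S w \<noteq> {} \<longleftrightarrow> z \<in> S u \<and> z \<in> S w"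
      using segments_meet_at_ends[OF A[OF uw(1)] B[OF uw(2)] neq] only by blast
    then show ?thesis
      using end_in_segment_iff[OF A[OF uw(1)] z(1)] end_in_segment_iff[OF B[OF uw(2)] z(2)] by auto
  qed
  have oppA: "opposed \<rho> A (\<lambda>u. gap s t (x u) (y u) z) (\<lambda>_. 0) \<or>
      opposed \<rho> A (\<lambda>_. 0) (\<lambda>u. gap s t (x u) (y u) z)"
    using opA by (auto simp: opposed_def gap_def)
  have oppB: "opposed \<rho> B (\<lambda>u. - gap s' t' (x u) (y u) z) (\<lambda>_. 0) \<or>
      opposed \<rho> B (\<lambda>_. 0) (\<lambda>u. - gap s' t' (x u) (y u) z)"
    using opB by (auto simp: opposed_def gap_def)
  show ?thesis
  proof (rule compatible_if_opposed[OF AB(3) inj oppA oppB])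
    fix u w assume uw: "u \<in> A" "w \<in> B"
    then have "u \<in> verts G" "w \<in> verts G" "u \<noteq> w" using AB by auto
    then show "{u, w} \<in> edges G \<longleftrightarrow> gap s t (x u) (y u) z \<le> - gap s' t' (x w) (y w) z \<and> (0::int) \<le> 0"
      using edge_iff meet[OF uw] by simp
  qed simp
qed

text \<open>All paths of the class contain \<open>hd p\<close>, so with non-edges the condition is
  vacuous.\<close>

lemma compatible_tailed_self:
  assumes "A \<subseteq> verts G" "inj_on \<rho> A"
    and A: "\<And>u. u \<in> A \<Longrightarrow> tailed p a d (x u) (y u) (S u)"
  shows "compatible G \<rho> A A"
proof (rule compatible_diagonal[OF assms(2), of "[verts G]\<^bsup>2\<^esup> - edges G"])
  fix u v w assume uvw: "{u, v, w} \<subseteq> A" "\<rho> u < \<rho> v" "\<rho> v < \<rho> w" "{u, w} \<in> [verts G]\<^bsup>2\<^esup> - edges G"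
  have "hd p \<in> S u \<inter> S w" using A uvw(1) by (auto simp: tailed_def walk_def)
  moreover have "u \<noteq> w" using uvw(2,3) by auto
  then have "S u \<inter> S w = {}" using non_edge_iff[of u w] uvw(1,4) assms(1) by auto
  ultimately show "{u, v} \<in> [verts G]\<^bsup>2\<^esup> - edges G \<and> {v, w} \<in> [verts G]\<^bsup>2\<^esup> - edges G"
    by blast
qed simp

text \<open>A proper interval family: right ends increase with left ends, so if the outer two of
  three intervals meet, the middle one meets both.\<close>

lemma compatible_segment_self:
  assumes AV: "A \<subseteq> verts G" and inj: "inj_on \<rho> A" and op: "opposed \<rho> A (int \<circ> x) (\<lambda>w. - int (y w))"
    and A: "\<And>u. u \<in> A \<Longrightarrow> segment s t (x u) (y u) (S u)"
  shows "compatible G \<rho> A A"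
proof (rule compatible_diagonal[OF inj, of "edges G"])
  fix u v w assume uvw: "{u, v, w} \<subseteq> A" "\<rho> u < \<rho> v" "\<rho> v < \<rho> w" and e: "{u, w} \<in> edges G"
  have iff: "{u, v} \<in> edges G \<longleftrightarrow> x u \<le> y v \<and> x v \<le> y u" if "u \<in> A" "v \<in> A" "u \<noteq> v" for u v
    using edge_iff[of u v] segment_segment_same_iff[OF A[OF that(1)] A[OF that(2)]] that AV by auto
  have "x u \<le> x v" "x v \<le> x w" "y u \<le> y v" "y v \<le> y w"
    using op uvw by (auto simp: opposed_def)
  moreover have "x u \<le> y u" "x v \<le> y v" "x w \<le> y w"
    using A uvw(1) by (auto simp: segment_def)
  moreover have "u \<noteq> v" "v \<noteq> w" "u \<noteq> w" using uvw by auto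
  ultimately show "{u, v} \<in> edges G \<and> {v, w} \<in> edges G"
    using e iff uvw(1) by auto
qed simp

section \<open>Indexing and counting the classes\<close>

text \<open>The classes are indexed by triples \<open>(p, a, d)\<close>: a path of \<open>H\<close> with an edge
  at each end. The triples whose two edges leave the same vertex into the same edge are not
  needed for tailed paths, so the segments of an edge \<open>st\<close> can use \<open>([s], t, t)\<close>.\<close>

fun coordinates :: "'a list \<times> 'a \<times> 'a \<Rightarrow> nat \<Rightarrow> nat \<Rightarrow> 'a set \<Rightarrow> bool" where
  "coordinates (p, a, d) x y T \<longleftrightarrow> canonical p \<and>
     (if (hd p, a) = (last p, d) then \<exists>s. p = [s] \<and> oriented s a \<and> segment s a x y T
      else tailed p a d x y T)"

definition keys :: "('a list \<times> 'a \<times> 'a) set" where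
  "keys = {(p, a, d). canonical p \<and> walk p \<and> distinct p \<and> {hd p, a} \<in> edges H \<and> {last p, d} \<in> edges H}"

lemma coordinates_exist:
  assumes "T \<in> path_vertex_sets H'"
  shows "\<exists>\<kappa> x y. \<kappa> \<in> keys \<and> coordinates \<kappa> x y T"
  using path_vertex_set_cases[OF assms]
proof (elim disjE exE conjE)
  fix s t l r assume "oriented s t" and seg: "segment s t l r T"
  then have "coordinates ([s], t, t) l r T" by (simp add: canonical_singleton)
  moreover have "([s], t, t) \<in> keys"
    using seg edge_verts by (auto simp: keys_def segment_def walk_def canonical_singleton)
  ultimately show ?thesis by blast
next
  fix p a d x y assume "canonical p" "tailed p a d x y T"
  then have "coordinates (p, a, d) x y T" "(p, a, d) \<in> keys"
    by (auto simp: keys_def tailed_def)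
  then show ?thesis by blast
qed

text \<open>Given \<open>p\<close>, the edge \<open>{hd p, a}\<close> determines \<open>a\<close>,
  and likewise for \<open>d\<close>; by canonicity \<open>p\<close> itself is determined by its
  subgraph. So a key amounts to a path of \<open>H\<close> with two edges.\<close>

lemma card_keys: "finite keys \<and> card keys \<le> (card (edges H))\<^sup>2 * num_paths H"
proof -
  define Z where "Z = {P. subgraph_of P H \<and> path_graph P} \<times> edges H \<times> edges H"
  define f where "f = (\<lambda>(p, a, d). (list_graph p, {hd p, a}, {last p, d :: 'a}))"
  have "finite (edges H)"
    using simple finite_imp_finite_nsets finite_subset unfolding simple_graph_def by blast
  then have fin: "finite Z" unfolding Z_def using finite_subgraphs[OF simple, of path_graph] by blast
  have "subgraph_of (list_graph p) H \<and> path_graph (list_graph p)" if "walk p" "distinct p" for p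
    using that consecutive_edges_in_nsets[of p]
    by (auto simp: subgraph_of_def path_graph_def list_graph_def simple_graph_def walk_def)
  then have sub: "f ` keys \<subseteq> Z" by (auto simp: f_def Z_def keys_def)
  have inj: "inj_on f keys"
  proof (rule inj_onI)
    fix \<kappa> \<kappa>' assume k: "\<kappa> \<in> keys" "\<kappa>' \<in> keys" "f \<kappa> = f \<kappa>'"
    obtain p a d p' a' d' where eq: "\<kappa> = (p, a, d)" "\<kappa>' = (p', a', d')" by (metis prod.exhaust)
    have "p = p'" using k canonical_inj by (auto simp: eq f_def keys_def)
    then have "{hd p, a} = {hd p, a'}" "{last p, d} = {last p, d'}"
      using k(3) by (auto simp: eq f_def)
    then show "\<kappa> = \<kappa>'" using \<open>p = p'\<close> by (auto simp: eq doubleton_eq_iff)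
  qed
  have "card keys \<le> card Z" by (rule card_inj_on_le[OF inj sub fin])
  also have "\<dots> = (card (edges H))\<^sup>2 * num_paths H"
    by (simp add: Z_def card_cartesian_product num_paths_def power2_eq_square)
  finally show ?thesis using inj_on_finite[OF inj sub fin] by blast
qed

lemma compatible_classes:
  fixes \<kappa> :: "'v \<Rightarrow> 'a list \<times> 'a \<times> 'a" and x y :: "'v \<Rightarrow> nat"
  assumes antichain: "\<And>u v. \<lbrakk>u \<in> verts G; v \<in> verts G; S u \<subseteq> S v\<rbrakk> \<Longrightarrow> u = v"
    and coord: "\<And>v. v \<in> verts G \<Longrightarrow> coordinates (\<kappa> v) (x v) (y v) (S v)"
  defines "cls \<equiv> \<lambda>k. {v \<in> verts G. \<kappa> v = k}"
  shows "inj_on (int \<circ> x) (cls k)" and "compatible G (int \<circ> x) (cls k) (cls k')"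
proof -
  \<comment> \<open>The first coordinate ranks every class. It is injective there: of two paths with
    equal \<open>x\<close>, one contains the other however their \<open>y\<close> compare.\<close>
  define \<rho> where "\<rho> = int \<circ> x"
  have key_cases: "(\<exists>p a d. k = (p, a, d) \<and> (\<forall>v\<in>cls k. tailed p a d (x v) (y v) (S v))) \<or>
    (\<exists>s t. k = ([s], t, t) \<and> oriented s t \<and> (\<forall>v\<in>cls k. segment s t (x v) (y v) (S v)))"
    if ne: "cls k \<noteq> {}" for k
  proof -
    obtain p a d where k: "k = (p, a, d)" by (metis prod.exhaust)
    have c: "coordinates (p, a, d) (x v) (y v) (S v)" if "v \<in> cls k" for v
      using coord[of v] that k by (auto simp: cls_def)
    show ?thesis
    proof (cases "(hd p, a) = (last p, d)")
      case True
      obtain v where "v \<in> cls k" using ne by blast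
      then obtain s where "p = [s]" "oriented s a" using c[of v] True by auto
      then show ?thesis using c True k by auto
    next
      case False
      then show ?thesis using c k by auto
    qed
  qed
  have tailed: "inj_on \<rho> (cls k) \<and> opposed \<rho> (cls k) (int \<circ> x) (int \<circ> y)"
    if t: "\<forall>v\<in>cls k. tailed p a d (x v) (y v) (S v)" for k p a d
  proof -
    have "u = v" if "u \<in> cls k" "v \<in> cls k" "x u \<le> x v" "y u \<le> y v" for u v
      using antichain[of u v] tailed_mono[of p a d "x u" "y u" "S u"] t that by (auto simp: cls_def)
    then show ?thesis
      unfolding inj_on_def opposed_def \<rho>_def comp_def of_nat_le_iff of_nat_eq_iff
      by (metis nle_le order.refl)
  qed
  have segment: "inj_on \<rho> (cls k) \<and> opposed \<rho> (cls k) (int \<circ> x) (\<lambda>v. - int (y v))"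
    if t: "\<forall>v\<in>cls k. segment s t (x v) (y v) (S v)" for k s t
  proof -
    have "u = v" if "u \<in> cls k" "v \<in> cls k" "x u \<le> x v" "y v \<le> y u" for u v
      using antichain[of v u] segment_mono[of s t "x v" "y v" "S v"] t that by (auto simp: cls_def)
    then show ?thesis
      unfolding inj_on_def opposed_def \<rho>_def comp_def of_nat_le_iff of_nat_eq_iff neg_le_iff_le
      by (metis nle_le order.refl)
  qed
  have inj: "inj_on \<rho> (cls k)" for k
    using key_cases[of k] tailed[of k] segment[of k] by (cases "cls k = {}") auto
  then show "inj_on (int \<circ> x) (cls k)" by (simp add: \<rho>_def)
  have V: "cls k \<subseteq> verts G" for k by (auto simp: cls_def)
  have disj: "cls k \<inter> cls k' = {}" if "k \<noteq> k'" for k k' using that by (auto simp: cls_def)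
  have "compatible G \<rho> (cls k) (cls k')"
  \<comment> \<open>Only a member of the class guarantees that \<open>k\<close> has one of the two
    forms in \<open>key_cases\<close>.\<close>
  proof (cases "cls k = {} \<or> cls k' = {}")
    case True
    then show ?thesis using compatible_empty[OF inj] compatible_sym by metis
  next
    case ne: False
    show ?thesis
    proof (cases "k = k'")
      case True
      then show ?thesis
        using key_cases[of k] ne compatible_tailed_self[OF V inj] segment
          compatible_segment_self[OF V inj] by metis
    next
      case False
      note sets = V V disj[OF False] inj inj
      note sets' = V V disj[OF False[symmetric]] inj inj
      consider (tt) p a d p' a' d' where "\<forall>v\<in>cls k. tailed p a d (x v) (y v) (S v)"
          "\<forall>v\<in>cls k'. tailed p' a' d' (x v) (y v) (S v)"
        | (ts) p a d s t where "\<forall>v\<in>cls k. tailed p a d (x v) (y v) (S v)"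
          "\<forall>v\<in>cls k'. segment s t (x v) (y v) (S v)"
        | (st) p a d s t where "\<forall>v\<in>cls k. segment s t (x v) (y v) (S v)"
          "\<forall>v\<in>cls k'. tailed p a d (x v) (y v) (S v)"
        | (ss) s t s' t' where "\<forall>v\<in>cls k. segment s t (x v) (y v) (S v)"
          "\<forall>v\<in>cls k'. segment s' t' (x v) (y v) (S v)" "oriented s t" "oriented s' t'"
          "k = ([s], t, t)" "k' = ([s'], t', t')"
        using key_cases[of k] key_cases[of k'] ne by metis
      then show ?thesis
      proof cases
        case tt
        then show ?thesis
          using tailed[OF tt(1)] tailed[OF tt(2)]
          by (intro compatible_tailed_tailed[OF sets, of x y p a d p' a' d']) auto
      next
        case ts
        then show ?thesis
          using tailed[OF ts(1)] segment[OF ts(2)]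
          by (intro compatible_tailed_segment[OF sets, of x y p a d s t]) auto
      next
        case st
        then show ?thesis
          using tailed[OF st(2)] segment[OF st(1)]
          by (intro compatible_sym[OF compatible_tailed_segment[OF sets', of x y p a d s t]]) auto
      next
        case ss
        \<comment> \<open>Each edge is used in one direction only, so different keys of segments
          belong to different edges.\<close>
        then have "{s, t} \<noteq> {s', t'}" using oriented_inj[OF ss(3,4)] False by auto
        then show ?thesis
          using ss segment[OF ss(1)] segment[OF ss(2)]
          by (intro compatible_segment_segment[OF sets, of x y s t s' t']) auto
      qed
    qed
  qed
  then show "compatible G (int \<circ> x) (cls k) (cls k')" by (simp add: \<rho>_def)
qed

lemma proper_mixed_thin:
  assumes paths: "\<And>v. v \<in> verts G \<Longrightarrow> S v \<in> path_vertex_sets H'"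
    and antichain: "\<And>u v. \<lbrakk>u \<in> verts G; v \<in> verts G; S u \<subseteq> S v\<rbrakk> \<Longrightarrow> u = v"
    and n: "0 < n" "card keys \<le> n"
  shows "proper_mixed_thin n G"
proof -
  have "\<forall>v. \<exists>\<kappa> x y. v \<in> verts G \<longrightarrow> \<kappa> \<in> keys \<and> coordinates \<kappa> x y (S v)"
    using coordinates_exist paths by meson
  then obtain \<kappa> x y where \<kappa>: "\<And>v. v \<in> verts G \<Longrightarrow> \<kappa> v \<in> keys"
    and coord: "\<And>v. v \<in> verts G \<Longrightarrow> coordinates (\<kappa> v) (x v) (y v) (S v)"
    by metis
  \<comment> \<open>Numbers the keys; a number that is not taken names an empty part.\<close>
  obtain f where f: "inj_on f keys" "f ` keys \<subseteq> {1..n}"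
    using card_le_inj[of keys "{1..n}"] card_keys n by auto
  note compatible = compatible_classes[OF antichain coord]
  have cls: "{v \<in> verts G. f (\<kappa> v) = f k} = {v \<in> verts G. \<kappa> v = k}" if "k \<in> keys" for k
    using that \<kappa> f(1) by (auto simp: inj_on_def)
  have cls_empty: "{v \<in> verts G. f (\<kappa> v) = i} = {}" if "i \<notin> f ` keys" for i
    using that \<kappa> by auto
  have inj: "inj_on (int \<circ> x) {v \<in> verts G. f (\<kappa> v) = i}" for i
  proof (cases "i \<in> f ` keys")
    case True
    then obtain k where "k \<in> keys" "i = f k" by blast
    then show ?thesis using compatible(1)[of k] cls by (simp only:)
  next
    case False
    then show ?thesis by (subst cls_empty) simp_all
  qed
  show ?thesis
  proof (rule proper_mixed_thin_if_compatible[OF n(1), of "f \<circ> \<kappa>" G "int \<circ> x"])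
    show "(f \<circ> \<kappa>) ` verts G \<subseteq> {1..n}" using \<kappa> f(2) by auto
    fix i j
    show "compatible G (int \<circ> x) {v \<in> verts G. (f \<circ> \<kappa>) v = i} {v \<in> verts G. (f \<circ> \<kappa>) v = j}"
    proof (cases "i \<in> f ` keys \<and> j \<in> f ` keys")
      case True
      then obtain k l where "k \<in> keys" "l \<in> keys" "i = f k" "j = f l" by blast
      then show ?thesis using compatible(2)[of k l] cls by (simp only: comp_apply)
    next
      case False
      then consider "i \<notin> f ` keys" | "j \<notin> f ` keys" by blast
      then show ?thesis
      proof cases
        case 1
        show ?thesis
          using compatible_empty[OF inj, of G j] cls_empty[OF 1] by (simp only: comp_apply)
      next
        case 2
        show ?thesis
          using compatible_sym[OF compatible_empty[OF inj, of G i]] cls_empty[OF 2]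
          by (simp only: comp_apply)
      qed
    qed
  qed
qed

end

lemma connected_no_isolated:
  assumes "simple_graph H" "connected_graph H" "edges H \<noteq> {}" "v \<in> verts H"
  shows "\<exists>w. {v, w} \<in> edges H"
proof -
  obtain e where "e \<in> edges H" using assms(3) by blast
  then have "e \<in> [verts H]\<^bsup>2\<^esup>" using assms(1) by (auto simp: simple_graph_def)
  then obtain a b where "a \<noteq> b" "a \<in> verts H" "b \<in> verts H" by (rule nsets2_E)
  then obtain c where c: "c \<in> verts H" "c \<noteq> v" by metis
  then have "(v, c) \<in> {(x, y). {x, y} \<in> edges H}\<^sup>*"
    using assms(2,4) by (simp add: connected_graph_def)
  then show ?thesis using c(2) by (cases rule: converse_rtranclE) auto
qed

lemma num_paths_pos:
  assumes "simple_graph H" "verts H \<noteq> {}"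
  shows "0 < num_paths H"
proof -
  obtain v where v: "v \<in> verts H" using assms by blast
  have "subgraph_of ({v}, {}) H \<and> path_graph ({v}, {})"
    using v by (auto simp: subgraph_of_def path_graph_def simple_graph_def intro!: exI[of _ "[v]"])
  moreover have "finite {P. subgraph_of P H \<and> path_graph P}"
    by (rule finite_subgraphs[OF assms(1)])
  ultimately show ?thesis unfolding num_paths_def by (auto simp: card_gt_0_iff)
qed

theorem theorem3p5:
  fixes G :: "'v sgraph" and H H' :: "'a sgraph" and m k :: nat
  assumes "simple_graph H" and "connected_graph H"
    and "m = card (edges H)" and "m > 0"
    and "k = num_paths H + num_cycles H"
    and "simple_graph G"
    and "subdivision_of H H'"
    and "proper_intersection_graph G (path_vertex_sets H')"
  shows "proper_mixed_thin (m ^ 2 * k) G"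
proof -
  obtain I where I: "segments H I" "verts H' = verts H \<union> segments.inner I (edges H)"
    "edges H' \<subseteq> segments.chain_edges H I"
    using subdivision_segments assms(1,7) by metis
  obtain S where S: "\<forall>v\<in>verts G. S v \<in> path_vertex_sets H'" "intersection_graph_of G S"
    "\<forall>u\<in>verts G. \<forall>v\<in>verts G. u \<noteq> v \<longrightarrow> \<not> S u \<subseteq> S v"
    using assms(8) unfolding proper_intersection_graph_def by blast
  have "edges H \<noteq> {}" using assms(3,4) by auto
  then interpret path_intersection_graph H I H' G S
    using I S(2) connected_no_isolated[OF assms(1,2)]
    by (auto simp: path_intersection_graph_def path_intersection_graph_axioms_def
        subdivided_def subdivided_axioms_def)
  have "0 < num_paths H"
    using assms(2) num_paths_pos[OF assms(1)] unfolding connected_graph_def by blast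
  then have "0 < m ^ 2 * k" using assms(4,5) by simp
  moreover have "card keys \<le> m ^ 2 * k"
    using card_keys assms(3,5) by (simp add: add_mult_distrib2)
  ultimately show ?thesis using proper_mixed_thin S by blast
qed

end
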